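(* Let $m_0=\sum_{i=1}^N a_i\delta_{x_i}$ be a discrete dyadic measure on $\mathbb{T}$ which satisfies the Non Degenerate Source Condition, and let $y_0=\Phi m_0$. For $n$ large enough, let $\varepsilon^n\in\{+1,-1\}^N$ be such that $$\operatorname{supp}^{\pm}(m_0)\subset\operatorname{Ext}^{\pm}_{\mathcal{G}_n}(m_0)\subset\operatorname{supp}^{\pm}(m_0)\cup\Big\{\Big(x_i+\frac{\varepsilon^n_i}{2^n},\eta_0^{\mathcal{G}_n}(x_i)\Big):1\le i\le N\Big\}$$ (such an $\varepsilon^n$ exists for $n$ large enough). Then, for $n$ large enough, there exist two constants $\alpha(n)>0$ and $\lambda_0(n)>0$ such that, for $\frac{\|w\|_2}{\lambda}<\alpha(n)$ and $0<\lambda<\lambda_0(n)$ (with $w\in L^2(\mathbb{T})$), any solution $\tilde m_\lambda^{\mathcal{G}_n}$ of $\mathcal{P}_\lambda^{\mathcal{G}_n}(y_0+w)$ has support in $\{x_i:1\le i\le N\}\cup\{x_i+\frac{\varepsilon^n_i}{2^n}:1\le i\le N\}$, with signs $\eta_0^{\mathcal{G}_n}(x_i)$, $1\le i\le N$ (i.e. the mass of $\tilde m_\lambda^{\mathcal{G}_n}$ at $x_i$ and at $x_i+\varepsilon_i^n/2^n$, if nonzero, has sign $\eta_0^{\mathcal{G}_n}(x_i)$).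
   Context: $\mathbb{T}=\mathbb{R}/\mathbb{Z}$. $\mathcal{M}(\mathbb{T})$ is the space of real Radon measures on $\mathbb{T}$ and $\|m\|_{TV}=\sup\{\int\psi\,dm:\psi\in C(\mathbb{T}),\|\psi\|_\infty\le1\}$. Fix a real-valued $\varphi\in C^2(\mathbb{T})$ and let $\Phi:\mathcal{M}(\mathbb{T})\to L^2(\mathbb{T})$, $(\Phi m)(t)=\int_{\mathbb{T}}\varphi(x-t)\,dm(x)$, with adjoint $\Phi^*:L^2(\mathbb{T})\to C(\mathbb{T})$, $(\Phi^*p)(t)=\int_{\mathbb{T}}\varphi(t-x)p(x)\,dx$. In $m_0=\sum_{i=1}^N a_i\delta_{x_i}$ the $a_i$ are nonzero reals and the $x_i$ pairwise distinct; $\operatorname{supp}^{\pm}(m_0)=\{(x_i,\operatorname{sign}a_i):1\le i\le N\}$. It is dyadic if for some $n_0\in\mathbb{N}$ every $x_i$ is of the form $j_i/2^{n_0}$ with $0\le j_i\le2^{n_0}-1$. $\partial\|m\|_{TV}=\{\eta\in C(\mathbb{T}):\|\eta\|_\infty\le1,\ \int\eta\,dm=\|m\|_{TV}\}$. $\mathcal{D}_0(y_0)$ is the problem $\sup\{\langle y_0,p\rangle:p\in L^2(\mathbb{T}),\ \|\Phi^*p\|_\infty\le1\}$; when it has a solution, $\eta_0=\Phi^*p_0$ where $p_0$ is its solution of minimal $L^2$ norm. Non Degenerate Source Condition for $m_0$: there exists $\eta\in\operatorname{Im}\Phi^*$ with $\eta\in\partial\|m_0\|_{TV}$ (this makes $\eta_0$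 well defined), $|\eta_0(s)|<1$ for all $s\in\mathbb{T}\setminus\{x_1,\dots,x_N\}$, and $\eta_0''(x_i)\neq0$ for all $i$. Dyadic grids: $\mathcal{G}_n=\{j/2^n:0\le j\le2^n-1\}$. $\mathcal{P}_\lambda^{\mathcal{G}_n}(y)$, $\lambda>0$, is $\min_{m\in\mathcal{M}(\mathbb{T})}\frac12\|\Phi m-y\|_2^2+\lambda\|m\|_{TV,\mathcal{G}_n}$, where $\|m\|_{TV,\mathcal{G}_n}=\sum_{t\in\mathcal{G}_n}|m(\{t\})|$ if $\operatorname{supp}m\subset\mathcal{G}_n$ and $+\infty$ otherwise. $\mathcal{D}_0^{\mathcal{G}_n}(y_0)$ is $\sup\{\langle y_0,p\rangle:p\in L^2(\mathbb{T}),\ \max_{t\in\mathcal{G}_n}|(\Phi^*p)(t)|\le1\}$ (for $n\ge n_0$ it has a solution); $p_0^{\mathcal{G}_n}$ is its solution of minimal $L^2$ norm and $\eta_0^{\mathcal{G}_n}=\Phi^*p_0^{\mathcal{G}_n}$. $\operatorname{Ext}^{\pm}_{\mathcal{G}_n}(m_0)=\{(t,v)\in\mathcal{G}_n\times\{-1,+1\}:\eta_0^{\mathcal{G}_n}(t)=v\}$. *)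

theory Defs
  imports "HOL-Analysis.Analysis"
begin

section \<open>The torus\<close>

quotient_type torus = real / "\<lambda>s t :: real. s - t \<in> \<int>"
proof (rule equivpI)
  show "reflp (\<lambda>s t :: real. s - t \<in> \<int>)"
    by (simp add: reflp_def)
  show "symp (\<lambda>s t :: real. s - t \<in> \<int>)"
    by (metis (no_types, lifting) Ints_minus minus_diff_eq sympI)
  show "transp (\<lambda>s t :: real. s - t \<in> \<int>)"
  proof (rule transpI)
    fix r s t :: real
    assume "r - s \<in> \<int>" "s - t \<in> \<int>"
    then have "(r - s) + (s - t) \<in> \<int>" by (rule Ints_add)
    then show "r - t \<in> \<int>" by simp
  qed
qed

lift_definition torus_of :: "real \<Rightarrow> torus" is "\<lambda>s. s" .

instantiation torus :: ab_group_add
begin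

lift_definition zero_torus :: torus is "0 :: real" .

lift_definition plus_torus :: "torus \<Rightarrow> torus \<Rightarrow> torus" is "(+) :: real \<Rightarrow> real \<Rightarrow> real"
proof -
  fix r s t u :: real
  assume "r - s \<in> \<int>" "t - u \<in> \<int>"
  then have "(r - s) + (t - u) \<in> \<int>" by (rule Ints_add)
  then show "(r + t) - (s + u) \<in> \<int>" by (simp add: algebra_simps)
qed

lift_definition minus_torus :: "torus \<Rightarrow> torus \<Rightarrow> torus" is "(-) :: real \<Rightarrow> real \<Rightarrow> real"
proof -
  fix r s t u :: real
  assume "r - s \<in> \<int>" "t - u \<in> \<int>"
  then have "(r - s) - (t - u) \<in> \<int>" by (rule Ints_diff)
  then show "(r - t) - (s - u) \<in> \<int>" by (simp add: algebra_simps)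
qed

lift_definition uminus_torus :: "torus \<Rightarrow> torus" is "uminus :: real \<Rightarrow> real"
proof -
  fix r s :: real
  assume "r - s \<in> \<int>"
  then have "- (r - s) \<in> \<int>" by (rule Ints_minus)
  then show "- r - - s \<in> \<int>" by simp
qed

instance
  by standard (transfer; simp)+

end

instantiation torus :: topological_space
begin

definition open_torus :: "torus set \<Rightarrow> bool"
  where "open_torus U \<longleftrightarrow> open (torus_of -` U)"

instance
  by standard (auto simp: open_torus_def vimage_Union)

end

lemma torus_of_eq_iff: "torus_of s = torus_of t \<longleftrightarrow> s - t \<in> \<int>"
  by transfer simp

lemma torus_of_add: "torus_of (s + t) = torus_of s + torus_of t"
  by transfer simp

lemma continuous_on_torus_of: "continuous_on UNIV torus_of"
  by (simp add: continuous_on_open_vimage open_torus_def)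

lemma measurable_torus_of: "torus_of \<in> measurable borel borel"
  by (rule borel_measurable_continuous_onI[OF continuous_on_torus_of])

definition haar :: "torus measure"
  where "haar = distr (restrict_space lborel {0..<1}) borel torus_of"

lemma emeasure_haar_UNIV: "emeasure haar UNIV = 1"
proof -
  have "torus_of \<in> measurable (restrict_space lborel {0..<1}) borel"
    by (rule measurable_restrict_space1) (simp add: measurable_torus_of)
  then show ?thesis
    by (simp add: haar_def emeasure_distr space_restrict_space emeasure_restrict_space)
qed

definition torus_deriv :: "(torus \<Rightarrow> real) \<Rightarrow> torus \<Rightarrow> real"
  where "torus_deriv f x = deriv (\<lambda>s. f (x + torus_of s)) 0"

definition torus_differentiable :: "(torus \<Rightarrow> real) \<Rightarrow> bool"
  where "torus_differentiable f \<longleftrightarrow> (\<forall>x. (\<lambda>s. f (x + torus_of s)) differentiable (at 0))"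

definition C2_torus :: "(torus \<Rightarrow> real) \<Rightarrow> bool"
  where "C2_torus f \<longleftrightarrow> torus_differentiable f \<and> torus_differentiable (torus_deriv f)
    \<and> continuous_on UNIV (torus_deriv (torus_deriv f))"


section \<open>Real Radon measures\<close>

text \<open>On the torus, a compact metrizable space, the real Radon measures are exactly the
  countably additive real set functions on the Borel sets. They are extended by 0 outside the
  Borel sets, so that equality of measures is equality of functions.\<close>

definition radon_measures :: "(torus set \<Rightarrow> real) set"
  where "radon_measures = {m. (\<forall>A. A \<notin> sets borel \<longrightarrow> m A = 0) \<and>
    (\<forall>A :: nat \<Rightarrow> torus set. range A \<subseteq> sets borel \<longrightarrow> disjoint_family A \<longrightarrow>
      (\<lambda>i. m (A i)) sums m (\<Union>i. A i))}"

text \<open>The positive part in the Jordan decomposition; the negative part is the positive part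
  of the opposite measure.\<close>

definition pos_part :: "(torus set \<Rightarrow> real) \<Rightarrow> torus measure"
  where "pos_part m = measure_of UNIV (sets borel)
    (\<lambda>A. ennreal (SUP B\<in>{B \<in> sets borel. B \<subseteq> A}. m B))"

definition signed_integral :: "(torus set \<Rightarrow> real) \<Rightarrow> (torus \<Rightarrow> real) \<Rightarrow> real"
  where "signed_integral m f =
    (LINT x|pos_part m. f x) - (LINT x|pos_part (\<lambda>A. - m A). f x)"

definition measure_support :: "(torus set \<Rightarrow> real) \<Rightarrow> torus set"
  where "measure_support m =
    {x. \<forall>U. open U \<longrightarrow> x \<in> U \<longrightarrow> (\<exists>A \<in> sets borel. A \<subseteq> U \<and> m A \<noteq> 0)}"

definition tv_norm :: "(torus set \<Rightarrow> real) \<Rightarrow> real"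
  where "tv_norm m =
    Sup {signed_integral m \<psi> | \<psi>. continuous_on UNIV \<psi> \<and> (\<forall>x. \<bar>\<psi> x\<bar> \<le> 1)}"

definition tv_subdifferential :: "(torus set \<Rightarrow> real) \<Rightarrow> (torus \<Rightarrow> real) set"
  where "tv_subdifferential m = {\<eta>. continuous_on UNIV \<eta> \<and> (\<forall>x. \<bar>\<eta> x\<bar> \<le> 1)
    \<and> signed_integral m \<eta> = tv_norm m}"

definition discrete_measure :: "nat \<Rightarrow> (nat \<Rightarrow> real) \<Rightarrow> (nat \<Rightarrow> torus) \<Rightarrow> torus set \<Rightarrow> real"
  where "discrete_measure N a x =
    (\<lambda>A. if A \<in> sets borel then \<Sum>i=1..N. a i * indicator A (x i) else 0)"

definition signed_support :: "nat \<Rightarrow> (nat \<Rightarrow> real) \<Rightarrow> (nat \<Rightarrow> torus) \<Rightarrow> (torus \<times> real) set"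
  where "signed_support N a x = {(x i, sgn (a i)) | i. i \<in> {1..N}}"


section \<open>Square-integrable functions and the operator\<close>

text \<open>Elements of the Lebesgue space are handled through representatives.\<close>

definition L2 :: "(torus \<Rightarrow> real) set"
  where "L2 = {p. p \<in> borel_measurable borel \<and> integrable haar (\<lambda>t. (p t)\<^sup>2)}"

definition L2_inner :: "(torus \<Rightarrow> real) \<Rightarrow> (torus \<Rightarrow> real) \<Rightarrow> real"
  where "L2_inner p q = (LINT t|haar. p t * q t)"

definition L2_norm :: "(torus \<Rightarrow> real) \<Rightarrow> real"
  where "L2_norm p = sqrt (L2_inner p p)"

definition conv_op :: "(torus \<Rightarrow> real) \<Rightarrow> (torus set \<Rightarrow> real) \<Rightarrow> torus \<Rightarrow> real"
  where "conv_op \<phi> m t = signed_integral m (\<lambda>x. \<phi> (x - t))"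

definition conv_adj :: "(torus \<Rightarrow> real) \<Rightarrow> (torus \<Rightarrow> real) \<Rightarrow> torus \<Rightarrow> real"
  where "conv_adj \<phi> p t = (LINT x|haar. \<phi> (t - x) * p x)"


section \<open>Dual problems and certificates\<close>

text \<open>The parameter \<^term>\<open>S\<close> is the set on which the dual constraint is imposed:
  the whole torus, or a grid.\<close>

definition dual_feasible :: "(torus \<Rightarrow> real) \<Rightarrow> torus set \<Rightarrow> (torus \<Rightarrow> real) set"
  where "dual_feasible \<phi> S = {p \<in> L2. \<forall>t\<in>S. \<bar>conv_adj \<phi> p t\<bar> \<le> 1}"

definition dual_solutions ::
    "(torus \<Rightarrow> real) \<Rightarrow> torus set \<Rightarrow> (torus \<Rightarrow> real) \<Rightarrow> (torus \<Rightarrow> real) set"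
  where "dual_solutions \<phi> S y =
    {p. is_arg_max (L2_inner y) (\<lambda>q. q \<in> dual_feasible \<phi> S) p}"

text \<open>A solution of minimal norm is unique only up to null sets; the associated certificate
  does not depend on the representative that is picked.\<close>

definition min_norm_solution ::
    "(torus \<Rightarrow> real) \<Rightarrow> torus set \<Rightarrow> (torus \<Rightarrow> real) \<Rightarrow> torus \<Rightarrow> real"
  where "min_norm_solution \<phi> S y =
    (SOME p. is_arg_min L2_norm (\<lambda>q. q \<in> dual_solutions \<phi> S y) p)"

definition certificate ::
    "(torus \<Rightarrow> real) \<Rightarrow> torus set \<Rightarrow> (torus \<Rightarrow> real) \<Rightarrow> torus \<Rightarrow> real"
  where "certificate \<phi> S y = conv_adj \<phi> (min_norm_solution \<phi> S y)"

definition nondegenerate_source_condition ::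
    "(torus \<Rightarrow> real) \<Rightarrow> nat \<Rightarrow> (nat \<Rightarrow> real) \<Rightarrow> (nat \<Rightarrow> torus) \<Rightarrow> bool"
  where "nondegenerate_source_condition \<phi> N a x \<longleftrightarrow>
    (let m\<^sub>0 = discrete_measure N a x; \<eta>\<^sub>0 = certificate \<phi> UNIV (conv_op \<phi> m\<^sub>0) in
      (\<exists>\<eta> \<in> conv_adj \<phi> ` L2. \<eta> \<in> tv_subdifferential m\<^sub>0) \<and>
      (\<forall>s. s \<notin> x ` {1..N} \<longrightarrow> \<bar>\<eta>\<^sub>0 s\<bar> < 1) \<and>
      (\<forall>i\<in>{1..N}. torus_deriv (torus_deriv \<eta>\<^sub>0) (x i) \<noteq> 0))"


section \<open>Dyadic grids\<close>

definition grid :: "nat \<Rightarrow> torus set"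
  where "grid n = {torus_of (real j / 2 ^ n) | j. j \<le> 2 ^ n - 1}"

definition dyadic :: "nat \<Rightarrow> (nat \<Rightarrow> torus) \<Rightarrow> bool"
  where "dyadic N x \<longleftrightarrow> (\<exists>n\<^sub>0. \<forall>i\<in>{1..N}. x i \<in> grid n\<^sub>0)"

definition tv_norm_grid :: "nat \<Rightarrow> (torus set \<Rightarrow> real) \<Rightarrow> ereal"
  where "tv_norm_grid n m =
    (if measure_support m \<subseteq> grid n then ereal (\<Sum>t\<in>grid n. \<bar>m {t}\<bar>) else \<infinity>)"

definition primal_solution_grid ::
    "(torus \<Rightarrow> real) \<Rightarrow> nat \<Rightarrow> real \<Rightarrow> (torus \<Rightarrow> real) \<Rightarrow> (torus set \<Rightarrow> real) \<Rightarrow> bool"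
  where "primal_solution_grid \<phi> n lam y m \<longleftrightarrow>
    is_arg_min
      (\<lambda>m. ereal (1 / 2 * (L2_norm (\<lambda>t. conv_op \<phi> m t - y t))\<^sup>2) + ereal lam * tv_norm_grid n m)
      (\<lambda>m. m \<in> radon_measures) m"

definition extended_support_grid ::
    "(torus \<Rightarrow> real) \<Rightarrow> nat \<Rightarrow> (torus \<Rightarrow> real) \<Rightarrow> (torus \<times> real) set"
  where "extended_support_grid \<phi> n y =
    {(t, v). t \<in> grid n \<and> v \<in> {-1, 1} \<and> certificate \<phi> (grid n) y t = v}"

end

theory Submission
  imports Defs
begin

text \<open>Modulo null sets, \<^term>\<open>L2\<close> is a Hilbert space, in which the certificates are the functions
  \<open>\<lambda>t. inner (kernel_at \<phi> t) P\<close>. By the source condition, the solutions of each dual problem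
  are the feasible vectors whose certificate takes the value \<open>sgn (a i)\<close> at \<open>x i\<close>. For
  finer and finer grids these closed convex sets decrease to the solution set of the limit problem,
  so the minimal norm solutions converge in norm and the certificates converge together with their
  first two derivatives. Hence for a fine grid the certificate is strictly concave, up to sign, near
  the spikes and of modulus less than 1 elsewhere, and strict concavity leaves at most one neighbour
  of each spike where it can reach the value at the spike. On a fixed grid, the rescaled
  residual of a primal solution tends to the minimal norm solution by the same argument on nested
  convex sets, and a primal solution charges only the points where the certificate of its rescaled
  residual is the sign of the mass.\<close>

text \<open>Weak compactness is replaced by the parallelogram identity: in a decreasing sequence of
  closed convex sets, almost minimal elements cluster, so convergence comes directly in norm,
  without a rate. This is used twice: for the grid faces as \<open>n\<close> grows and, with
  \<open>n\<close> fixed, for almost optimal dual vectors as \<open>lam\<close> tends to 0. A grid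
  constraint says nothing between grid points. The grid certificate may exceed 1 in modulus there,
  and its derivative need not vanish at a spike; this is how a neighbour of the spike can be
  saturated at all. Concavity near the spikes is therefore inherited from the limit certificate,
  which is extremal at each spike and has nonzero second derivative there. The constants \<alpha>
  and \<open>lam0\<close> depend on \<open>n\<close> through the gap between 1 and those moduli
  below 1 that the certificate takes on the finite grid. A dual vector whose values on the grid are
  closer than this gap to those of the minimal one can be saturated only where the latter is, and
  with the same sign.\<close>

section \<open>Minimal norm elements of nested convex sets\<close>

text \<open>The distances \<open>d n\<close> from 0 to \<open>K n\<close> increase to a limit
  \<open>D\<close>. Two points of \<open>K n\<close> with norm close to \<open>D\<close> have their
  midpoint in \<open>K n\<close>, of norm at least \<open>d n\<close>, so the parallelogram identity
  forces them together. The almost minimal slices of the \<open>K n\<close> thus have diameters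
  tending to 0, and the nested set theorem yields \<open>q\<close>, of norm at most
  \<open>D\<close>.\<close>

lemma nested_min_norm_approx:
  fixes K :: "nat \<Rightarrow> 'a::{real_inner,complete_space} set"
  assumes conv: "\<And>n. convex (K n)" and clo: "\<And>n. closed (K n)"
    and dec: "\<And>m n. m \<le> n \<Longrightarrow> K n \<subseteq> K m" and p: "\<And>n. p \<in> K n"
  obtains q where "\<And>n. q \<in> K n" and "\<And>e. e > 0 \<Longrightarrow> \<exists>n. \<forall>k\<in>K n. norm q \<le> norm k + e"
proof -
  define d where "d n = Inf (norm ` K n)" for n
  have bdd: "bdd_below (norm ` K n)" for n
    by (rule bdd_belowI[of _ 0]) auto
  have d_le: "d n \<le> norm k" if "k \<in> K n" for k n
    unfolding d_def using bdd that by (auto intro: cInf_lower)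
  have d_nonneg: "0 \<le> d n" for n
    unfolding d_def using p by (intro cInf_greatest) auto
  have d_mono: "d m \<le> d n" if "m \<le> n" for m n
    unfolding d_def[of n] using p dec[OF that] d_le[of _ m] by (intro cInf_greatest) auto
  have bdd_d: "bdd_above (range d)"
    using d_le[OF p] by (auto intro!: bdd_aboveI[of _ "norm p"])
  define D where "D = (SUP n. d n)"
  have dD: "d n \<le> D" for n
    unfolding D_def using bdd_d by (auto intro: cSUP_upper)
  have D_approx: "\<exists>n. D - e < d n" if "e > 0" for e
    using less_cSUP_iff[OF _ bdd_d, of "D - e"] that unfolding D_def[symmetric] by auto
  \<comment> \<open>The excess 1/(n+1) keeps each slice nonempty before any minimum is known to be
    attained, and it decreases so that the slices stay nested.\<close>
  define S where "S n = K n \<inter> cball 0 (D + 1 / (real n + 1))" for n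
  have S_near: "\<exists>n. \<forall>u\<in>S n. \<forall>v\<in>S n. dist u v < e" if "e > 0" for e
  proof -
    \<comment> \<open>With both norms at most \<open>D + c\<close> and \<open>d n > D - c\<close>,
      the parallelogram identity leaves \<open>c * (16 * D + 4 * c)\<close>; since
      \<open>c \<le> 1\<close>, this is below \<open>c * (16 * D + 5)\<close>.\<close>
    define c where "c = min 1 (e\<^sup>2 / (16 * D + 5))"
    have D0: "0 \<le> D" using d_nonneg dD order_trans by blast
    have den: "0 < 16 * D + 5" using D0 by linarith
    have c: "c > 0" "c \<le> 1" unfolding c_def using that den by auto
    have ce: "c * (16 * D + 5) \<le> e\<^sup>2"
    proof -
      have "c \<le> e\<^sup>2 / (16 * D + 5)" unfolding c_def by simp
      then show ?thesis using den by (simp add: pos_le_divide_eq)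
    qed
    obtain n1 where n1: "D - c < d n1" using D_approx c by blast
    obtain n2 where n2: "inverse (real (Suc n2)) < c" using reals_Archimedean c by blast
    define n where "n = max n1 n2"
    have dn: "D - c < d n" using n1 d_mono[of n1 n] by (auto simp: n_def)
    have "1 / (real n + 1) \<le> inverse (real (Suc n2))"
      unfolding n_def by (auto simp: divide_simps)
    with n2 have rn: "1 / (real n + 1) < c" by simp
    have "dist u v < e" if uv: "u \<in> S n" "v \<in> S n" for u v
    proof -
      have bounds: "norm u \<le> D + c" "norm v \<le> D + c"
        using uv rn by (auto simp: S_def)
      have "(1/2) *\<^sub>R u + (1/2) *\<^sub>R v \<in> K n"
        using uv conv[of n] by (intro convexD) (auto simp: S_def)
      then have "d n \<le> norm ((1/2) *\<^sub>R (u + v))"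
        using d_le by (simp add: scaleR_add_right)
      then have mid: "2 * d n \<le> norm (u + v)" by simp
      have "4 * (d n)\<^sup>2 \<le> (norm (u + v))\<^sup>2"
        using power_mono[OF mid, of 2] d_nonneg[of n] by (simp add: power_mult_distrib)
      moreover have "(norm (u - v))\<^sup>2 + (norm (u + v))\<^sup>2 = 2 * (norm u)\<^sup>2 + 2 * (norm v)\<^sup>2"
        by (simp add: power2_norm_eq_inner inner_add_left inner_add_right inner_diff_left
            inner_diff_right)
      moreover have "(norm u)\<^sup>2 \<le> (D + c)\<^sup>2" "(norm v)\<^sup>2 \<le> (D + c)\<^sup>2"
        using bounds by (auto intro: power_mono)
      \<comment> \<open>The inequality \<open>D - c < d n\<close> may be squared only if
        \<open>D - c\<close> is nonnegative; otherwise the left side \<open>D * (D - 2 * c)\<close>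
        is at most 0.\<close>
      moreover have "D\<^sup>2 - 2 * D * c \<le> (d n)\<^sup>2"
      proof (cases "c \<le> D")
        case True
        have "(D - c)\<^sup>2 \<le> (d n)\<^sup>2" using dn True by (intro power_mono) auto
        moreover have "(D - c)\<^sup>2 = D\<^sup>2 - 2 * D * c + c\<^sup>2" by (simp add: power2_diff)
        moreover have "0 \<le> c\<^sup>2" by simp
        ultimately show ?thesis by linarith
      next
        case False
        then have "D * (D - 2 * c) \<le> 0" using D0 c by (intro mult_nonneg_nonpos) auto
        moreover have "0 \<le> (d n)\<^sup>2" by simp
        moreover have "D * (D - 2 * c) = D\<^sup>2 - 2 * D * c"
          by (simp add: power2_eq_square algebra_simps)
        ultimately show ?thesis by linarith
      qed
      ultimately have "(norm (u - v))\<^sup>2 \<le>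
          2 * (D + c)\<^sup>2 + 2 * (D + c)\<^sup>2 - 4 * (D\<^sup>2 - 2 * D * c)"
        by argo
      also have "\<dots> = c * (16 * D + 4 * c)" by (simp add: power2_eq_square algebra_simps)
      also have "\<dots> < c * (16 * D + 5)" using c by simp
      also have "\<dots> \<le> e\<^sup>2" by (rule ce)
      finally show ?thesis using \<open>e > 0\<close> by (simp add: dist_norm power_less_imp_less_base)
    qed
    then show ?thesis by blast
  qed
  have S_ne: "S n \<noteq> {}" for n
  proof -
    have "Inf (norm ` K n) < D + 1 / (real n + 1)"
      using dD[of n] unfolding d_def by (smt (verit) divide_pos_pos of_nat_0_le_iff)
    then obtain k where "k \<in> K n" "norm k < D + 1 / (real n + 1)"
      using p cInf_less_iff[of "norm ` K n", OF _ bdd] by blast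
    then show ?thesis by (auto simp: S_def intro!: exI[of _ k])
  qed
  have S_dec: "S n \<subseteq> S m" if "m \<le> n" for m n
  proof -
    have "1 / (real n + 1) \<le> 1 / (real m + 1)" using that by (auto simp: divide_simps)
    then show ?thesis using dec[OF that] by (auto simp: S_def)
  qed
  have S_clo: "closed (S n)" for n
    unfolding S_def using clo by auto
  obtain q where q: "\<And>n. q \<in> S n"
    using decreasing_closed_nest[of S, OF S_clo S_ne S_dec S_near] by blast
  have "norm q \<le> D"
  proof (rule field_le_epsilon)
    fix e :: real assume "e > 0"
    then obtain n where "inverse (real (Suc n)) < e" using reals_Archimedean by blast
    moreover have "norm q \<le> D + 1 / (real n + 1)" using q[of n] by (auto simp: S_def)
    ultimately show "norm q \<le> D + e" by (simp add: inverse_eq_divide algebra_simps)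
  qed
  show ?thesis
  proof
    show "q \<in> K n" for n using q by (auto simp: S_def)
    fix e :: real assume "e > 0"
    then obtain n where "D - e < d n" using D_approx by blast
    then have "norm q \<le> norm k + e" if "k \<in> K n" for k
      using d_le[OF that] \<open>norm q \<le> D\<close> by linarith
    then show "\<exists>n. \<forall>k\<in>K n. norm q \<le> norm k + e" by blast
  qed
qed

corollary min_norm_exists:
  fixes K :: "'a::{real_inner,complete_space} set"
  assumes "convex K" "closed K" "K \<noteq> {}"
  obtains q where "q \<in> K" "\<And>k. k \<in> K \<Longrightarrow> norm q \<le> norm k"
proof -
  obtain p where "p \<in> K" using assms by auto
  obtain q where q: "q \<in> K" "\<And>e. e > 0 \<Longrightarrow> \<forall>k\<in>K. norm q \<le> norm k + e"
    by (rule nested_min_norm_approx[of "\<lambda>_. K" p]) (use assms \<open>p \<in> K\<close> in auto)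
  then show ?thesis using that by (metis field_le_epsilon)
qed

text \<open>The point \<open>q'\<close> from \<open>nested_min_norm_approx\<close> lies in every
  \<open>K n\<close>, so \<open>norm q\<close> is at most \<open>norm q'\<close>, hence at most
  \<open>d\<close> above the norm of any element of a late \<open>K n\<close>, midpoints with
  \<open>q\<close> included. The parallelogram identity then keeps \<open>k\<close> near
  \<open>q\<close>. Membership in one single set suffices, which is all that a perturbed problem can
  provide.\<close>

lemma nested_near_min_norm:
  fixes K :: "nat \<Rightarrow> 'a::{real_inner,complete_space} set"
  assumes conv: "\<And>n. convex (K n)" and clo: "\<And>n. closed (K n)"
    and dec: "\<And>m n. m \<le> n \<Longrightarrow> K n \<subseteq> K m" and q: "\<And>n. q \<in> K n"
    and min: "\<And>k. (\<And>n. k \<in> K n) \<Longrightarrow> norm q \<le> norm k"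
    and "e > 0"
  obtains d n where "d > 0" "\<And>k. k \<in> K n \<Longrightarrow> norm k \<le> norm q + d \<Longrightarrow> norm (k - q) < e"
proof -
  define Q where "Q = norm q"
  have Q0: "0 \<le> Q" by (simp add: Q_def)
  obtain q' where q': "\<And>n. q' \<in> K n" "\<And>e. e > 0 \<Longrightarrow> \<exists>n. \<forall>k\<in>K n. norm q' \<le> norm k + e"
    using nested_min_norm_approx[of K q] conv clo dec q by metis
  have "Q \<le> norm q'" unfolding Q_def using q'(1) by (rule min)
  \<comment> \<open>The estimate below ends in \<open>d * (12 * Q + 2 * d)\<close>, which is less
    than \<open>d * (12 * Q + 3)\<close> because \<open>d \<le> 1\<close>.\<close>
  define d where "d = min 1 (e\<^sup>2 / (12 * Q + 3))"
  have den: "0 < 12 * Q + 3" using Q0 by linarith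
  have d: "d > 0" "d \<le> 1" unfolding d_def using \<open>e > 0\<close> den by auto
  have de: "d * (12 * Q + 3) \<le> e\<^sup>2"
  proof -
    have "d \<le> e\<^sup>2 / (12 * Q + 3)" unfolding d_def by simp
    then show ?thesis using den by (simp add: pos_le_divide_eq)
  qed
  obtain n where n: "\<And>k. k \<in> K n \<Longrightarrow> norm q' \<le> norm k + d" using q'(2) d by blast
  have "norm (k - q) < e" if k: "k \<in> K n" "norm k \<le> norm q + d" for k
  proof -
    have "(1/2) *\<^sub>R k + (1/2) *\<^sub>R q \<in> K n"
      using k q conv[of n] by (intro convexD) auto
    from n[OF this] have "Q \<le> norm ((1/2) *\<^sub>R (k + q)) + d"
      using \<open>Q \<le> norm q'\<close> by (simp add: scaleR_add_right)
    then have mid: "2 * (Q - d) \<le> norm (k + q)" by simp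
    have "4 * Q\<^sup>2 - 8 * Q * d \<le> (norm (k + q))\<^sup>2"
    proof (cases "d \<le> Q")
      case True
      then have "(2 * (Q - d))\<^sup>2 \<le> (norm (k + q))\<^sup>2" using mid by (intro power_mono) auto
      moreover have "(2 * (Q - d))\<^sup>2 = 4 * Q\<^sup>2 - 8 * Q * d + 4 * d\<^sup>2"
        by (simp add: power2_eq_square algebra_simps)
      moreover have "0 \<le> d\<^sup>2" by simp
      ultimately show ?thesis by linarith
    next
      case False
      then have "4 * Q * (Q - 2 * d) \<le> 0" using Q0 d by (intro mult_nonneg_nonpos) auto
      moreover have "0 \<le> (norm (k + q))\<^sup>2" by simp
      moreover have "4 * Q * (Q - 2 * d) = 4 * Q\<^sup>2 - 8 * Q * d"
        by (simp add: power2_eq_square algebra_simps)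
      ultimately show ?thesis by linarith
    qed
    moreover have "(norm (k - q))\<^sup>2 + (norm (k + q))\<^sup>2 = 2 * (norm k)\<^sup>2 + 2 * Q\<^sup>2"
      unfolding Q_def
      by (simp add: power2_norm_eq_inner inner_add_left inner_add_right inner_diff_left
          inner_diff_right)
    moreover have "(norm k)\<^sup>2 \<le> (Q + d)\<^sup>2"
      using k by (auto intro: power_mono simp: Q_def)
    ultimately have "(norm (k - q))\<^sup>2 \<le> 2 * (Q + d)\<^sup>2 - 2 * Q\<^sup>2 + 8 * Q * d"
      by linarith
    also have "\<dots> = d * (12 * Q + 2 * d)" by (simp add: power2_eq_square algebra_simps)
    also have "\<dots> < d * (12 * Q + 3)" using d by simp
    also have "\<dots> \<le> e\<^sup>2" by (rule de)
    finally show ?thesis using \<open>e > 0\<close> by (simp add: power_less_imp_less_base)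
  qed
  with d show ?thesis using that by blast
qed

section \<open>The Hilbert space of square-integrable functions\<close>

lemma space_haar [simp]: "space haar = UNIV"
  by (simp add: haar_def)

lemma sets_haar [measurable_cong, simp]: "sets haar = sets borel"
  by (simp add: haar_def)

lemma measurable_haar_eq: "borel_measurable haar = borel_measurable borel"
  by (rule measurable_cong_sets) auto

interpretation haar: finite_measure haar
  by (rule finite_measureI) (simp add: emeasure_haar_UNIV)

lemma L2_measurable: "p \<in> L2 \<Longrightarrow> p \<in> borel_measurable haar"
  by (simp add: L2_def measurable_haar_eq)

lemma L2_square_integrable: "p \<in> L2 \<Longrightarrow> integrable haar (\<lambda>t. (p t)\<^sup>2)"
  by (simp add: L2_def)

lemma L2_I: "p \<in> borel_measurable haar \<Longrightarrow> integrable haar (\<lambda>t. (p t)\<^sup>2) \<Longrightarrow> p \<in> L2"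
  by (simp add: L2_def measurable_haar_eq)

lemma L2_mult_integrable:
  assumes "p \<in> L2" "q \<in> L2" shows "integrable haar (\<lambda>t. p t * q t)"
proof (rule Bochner_Integration.integrable_bound)
  show "integrable haar (\<lambda>t. (p t)\<^sup>2 + (q t)\<^sup>2)"
    using assms by (intro Bochner_Integration.integrable_add L2_square_integrable)
  show "(\<lambda>t. p t * q t) \<in> borel_measurable haar"
    using assms[THEN L2_measurable] by measurable
  have "\<bar>u * v\<bar> \<le> u\<^sup>2 + v\<^sup>2" for u v :: real
  proof -
    have "2 * (\<bar>u\<bar> * \<bar>v\<bar>) \<le> u\<^sup>2 + v\<^sup>2"
      using sum_squares_bound[of "\<bar>u\<bar>" "\<bar>v\<bar>"] by (simp add: mult.assoc)
    moreover have "0 \<le> \<bar>u\<bar> * \<bar>v\<bar>" by simp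
    ultimately show ?thesis unfolding abs_mult by linarith
  qed
  then show "AE t in haar. norm (p t * q t) \<le> norm ((p t)\<^sup>2 + (q t)\<^sup>2)"
    by simp
qed

lemma L2_add:
  assumes "p \<in> L2" "q \<in> L2" shows "(\<lambda>t. p t + q t) \<in> L2"
proof (rule L2_I)
  show "(\<lambda>t. p t + q t) \<in> borel_measurable haar"
    using assms by (intro borel_measurable_add L2_measurable)
  have "integrable haar (\<lambda>t. (p t)\<^sup>2 + (q t)\<^sup>2 + 2 * (p t * q t))"
    using assms by (intro Bochner_Integration.integrable_add integrable_mult_right
        L2_square_integrable L2_mult_integrable)
  then show "integrable haar (\<lambda>t. (p t + q t)\<^sup>2)"
    by (simp add: power2_sum mult.assoc)
qed

lemma L2_scale: "p \<in> L2 \<Longrightarrow> (\<lambda>t. c * p t) \<in> L2"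
  by (rule L2_I, intro borel_measurable_times borel_measurable_const L2_measurable)
    (auto simp: power_mult_distrib L2_square_integrable)

lemma L2_zero: "(\<lambda>t. 0) \<in> L2"
  by (rule L2_I) auto

lemma L2_uminus: "p \<in> L2 \<Longrightarrow> (\<lambda>t. - p t) \<in> L2"
  using L2_scale[of p "-1"] by simp

lemma L2_diff: "p \<in> L2 \<Longrightarrow> q \<in> L2 \<Longrightarrow> (\<lambda>t. p t - q t) \<in> L2"
  using L2_add[OF _ L2_uminus, of p q] by simp

\<comment> \<open>Passing to classes modulo null sets makes the inner product definite, so that the
  convexity lemmas above apply. The relation is partial: functions outside \<open>L2\<close>
  represent no class.\<close>
quotient_type l2 = "torus \<Rightarrow> real" / partial:
  "\<lambda>p q. p \<in> L2 \<and> q \<in> L2 \<and> (AE t in haar. p t = q t)"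
proof (rule part_equivpI)
  show "\<exists>p. p \<in> L2 \<and> p \<in> L2 \<and> (AE t in haar. p t = p t)"
    using L2_zero by (intro exI[of _ "\<lambda>t. 0"]) simp
  show "symp (\<lambda>p q. p \<in> L2 \<and> q \<in> L2 \<and> (AE t in haar. p t = q t))"
    by (rule sympI) (simp add: eq_commute)
  show "transp (\<lambda>p q. p \<in> L2 \<and> q \<in> L2 \<and> (AE t in haar. p t = q t))"
  proof (rule transpI, elim conjE, intro conjI)
    fix p q r :: "torus \<Rightarrow> real"
    assume "AE t in haar. p t = q t" "AE t in haar. q t = r t"
    then show "AE t in haar. p t = r t" by eventually_elim simp
  qed
qed

instantiation l2 :: real_inner
begin

lift_definition zero_l2 :: l2 is "\<lambda>t. 0" by (simp add: L2_zero)

lift_definition plus_l2 :: "l2 \<Rightarrow> l2 \<Rightarrow> l2" is "\<lambda>p q t. p t + q t"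
proof (intro conjI; (elim conjE)?)
  fix p p' q q' :: "torus \<Rightarrow> real"
  assume "AE t in haar. p t = p' t" "AE t in haar. q t = q' t"
  then show "AE t in haar. p t + q t = p' t + q' t" by eventually_elim simp
qed (simp_all add: L2_add)

lift_definition minus_l2 :: "l2 \<Rightarrow> l2 \<Rightarrow> l2" is "\<lambda>p q t. p t - q t"
proof (intro conjI; (elim conjE)?)
  fix p p' q q' :: "torus \<Rightarrow> real"
  assume "AE t in haar. p t = p' t" "AE t in haar. q t = q' t"
  then show "AE t in haar. p t - q t = p' t - q' t" by eventually_elim simp
qed (simp_all add: L2_diff)

lift_definition uminus_l2 :: "l2 \<Rightarrow> l2" is "\<lambda>p t. - p t"
  by (simp add: L2_uminus)

lift_definition scaleR_l2 :: "real \<Rightarrow> l2 \<Rightarrow> l2" is "\<lambda>c p t. c * p t"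
proof (intro conjI; (elim conjE)?)
  fix c :: real and p p' :: "torus \<Rightarrow> real"
  assume "AE t in haar. p t = p' t"
  then show "AE t in haar. c * p t = c * p' t" by eventually_elim simp
qed (simp_all add: L2_scale)

lift_definition inner_l2 :: "l2 \<Rightarrow> l2 \<Rightarrow> real" is L2_inner
  unfolding L2_inner_def
proof (rule integral_cong_AE; (elim conjE)?)
  fix p p' q q' :: "torus \<Rightarrow> real"
  assume "AE t in haar. p t = p' t" "AE t in haar. q t = q' t"
  then show "AE t in haar. p t * q t = p' t * q' t" by eventually_elim simp
qed (intro borel_measurable_times L2_measurable; assumption)+

definition norm_l2 :: "l2 \<Rightarrow> real" where "norm_l2 p = sqrt (inner p p)"
definition sgn_l2 :: "l2 \<Rightarrow> l2" where "sgn_l2 p = scaleR (inverse (norm p)) p"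
definition dist_l2 :: "l2 \<Rightarrow> l2 \<Rightarrow> real" where "dist_l2 p q = norm (p - q)"
definition uniformity_l2 :: "(l2 \<times> l2) filter"
  where "uniformity_l2 = (INF e\<in>{0<..}. principal {(p, q). dist p q < e})"
definition open_l2 :: "l2 set \<Rightarrow> bool"
  where "open_l2 U \<longleftrightarrow> (\<forall>p\<in>U. \<forall>\<^sub>F (p', q) in uniformity. p' = p \<longrightarrow> q \<in> U)"

instance
proof
  fix p q r :: l2 and a b :: real
  show "p + q + r = p + (q + r)" by transfer (auto simp: L2_add add.assoc)
  show "p + q = q + p" by transfer (auto simp: L2_add add.commute)
  show "0 + p = p" by transfer (auto simp: L2_add)
  show "- p + p = 0" by transfer (auto simp: L2_zero)
  show "p - q = p + - q" by transfer (auto simp: L2_add L2_uminus L2_diff)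
  show "a *\<^sub>R (p + q) = a *\<^sub>R p + a *\<^sub>R q"
    by transfer (auto simp: L2_add L2_scale distrib_left)
  show "(a + b) *\<^sub>R p = a *\<^sub>R p + b *\<^sub>R p"
    by transfer (auto simp: L2_add L2_scale distrib_right)
  show "a *\<^sub>R b *\<^sub>R p = (a * b) *\<^sub>R p" by transfer (auto simp: L2_scale mult.assoc)
  show "1 *\<^sub>R p = p" by transfer auto
  show "inner p q = inner q p" by transfer (simp add: L2_inner_def mult.commute)
  show "inner (p + q) r = inner p r + inner q r"
    by transfer (simp add: L2_inner_def distrib_right L2_mult_integrable)
  show "inner (a *\<^sub>R p) q = a * inner p q"
    by transfer (simp add: L2_inner_def mult.assoc)
  show "0 \<le> inner p p" by transfer (simp add: L2_inner_def)
  show "(inner p p = 0) = (p = 0)"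
  proof transfer
    fix p assume "p \<in> L2 \<and> p \<in> L2 \<and> (AE t in haar. p t = p t)"
    then show "(L2_inner p p = 0) =
        (p \<in> L2 \<and> (\<lambda>t. 0) \<in> L2 \<and> (AE t in haar. p t = 0))"
      unfolding L2_inner_def using L2_mult_integrable[of p p] L2_zero
      by (subst integral_nonneg_eq_0_iff_AE) auto
  qed
  show "norm p = sqrt (inner p p)" by (rule norm_l2_def)
  show "sgn p = scaleR (inverse (norm p)) p" by (rule sgn_l2_def)
  show "dist p q = norm (p - q)" by (rule dist_l2_def)
  show "uniformity = (INF e\<in>{0<..}. principal {(p, q). dist (p::l2) q < e})"
    by (rule uniformity_l2_def)
  show "open U = (\<forall>p\<in>U. \<forall>\<^sub>F (p', q) in uniformity. p' = p \<longrightarrow> q \<in> U)" for U :: "l2 set"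
    by (rule open_l2_def)
qed

end

text \<open>The value 0 outside \<open>L2\<close> serves to make the map total.\<close>

lift_definition toL2 :: "(torus \<Rightarrow> real) \<Rightarrow> l2" is "\<lambda>p. if p \<in> L2 then p else (\<lambda>t. 0)"
  by (simp add: L2_zero)

lemma toL2_surj:
  obtains q where "q \<in> L2" "toL2 q = p"
proof -
  have "\<exists>q. q \<in> L2 \<and> toL2 q = p"
    by transfer (auto intro: exI)
  then show ?thesis using that by blast
qed

lemma inner_toL2: "p \<in> L2 \<Longrightarrow> q \<in> L2 \<Longrightarrow> inner (toL2 p) (toL2 q) = L2_inner p q"
  by transfer simp

lemma norm_toL2: "p \<in> L2 \<Longrightarrow> norm (toL2 p) = L2_norm p"
  by (simp add: norm_eq_sqrt_inner inner_toL2 L2_norm_def)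

lemma toL2_add: "p \<in> L2 \<Longrightarrow> q \<in> L2 \<Longrightarrow> toL2 (\<lambda>t. p t + q t) = toL2 p + toL2 q"
  by transfer (simp add: L2_add)

lemma toL2_diff: "p \<in> L2 \<Longrightarrow> q \<in> L2 \<Longrightarrow> toL2 (\<lambda>t. p t - q t) = toL2 p - toL2 q"
  by transfer (simp add: L2_diff)

lemma toL2_scale: "p \<in> L2 \<Longrightarrow> toL2 (\<lambda>t. c * p t) = c *\<^sub>R toL2 p"
  by transfer (simp add: L2_scale)

lemma toL2_zero: "toL2 (\<lambda>t. 0) = 0"
  by transfer (simp add: L2_zero)

lemma L2_one: "(\<lambda>t. 1) \<in> L2"
  by (rule L2_I) auto

lemma norm_toL2_one: "norm (toL2 (\<lambda>t. 1)) = 1"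
  by (simp add: norm_toL2 L2_one L2_norm_def L2_inner_def measure_def emeasure_haar_UNIV)

lemma L2_abs:
  assumes "p \<in> L2" shows "(\<lambda>t. \<bar>p t\<bar>) \<in> L2"
  using assms L2_measurable[OF assms] L2_square_integrable[OF assms] by (intro L2_I) auto

lemma integrable_abs_L2:
  assumes "p \<in> L2" shows "integrable haar (\<lambda>t. \<bar>p t\<bar>)"
  using L2_mult_integrable[OF L2_one L2_abs[OF assms]] by simp

text \<open>Cauchy-Schwarz against the constant 1, the torus having total mass 1.\<close>

lemma integral_abs_le_norm:
  assumes "p \<in> L2" shows "(LINT t|haar. \<bar>p t\<bar>) \<le> norm (toL2 p)"
proof -
  have "(LINT t|haar. \<bar>p t\<bar>) = inner (toL2 (\<lambda>t. 1)) (toL2 (\<lambda>t. \<bar>p t\<bar>))"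
    using assms by (simp add: inner_toL2 L2_one L2_abs L2_inner_def)
  also have "\<dots> \<le> norm (toL2 (\<lambda>t. 1)) * norm (toL2 (\<lambda>t. \<bar>p t\<bar>))"
    by (rule norm_cauchy_schwarz)
  also have "\<dots> = norm (toL2 p)"
    using assms by (simp add: norm_toL2_one norm_toL2 L2_abs L2_norm_def L2_inner_def)
  finally show ?thesis .
qed

lemma nn_integral_square_toL2:
  assumes "p \<in> L2" shows "(\<integral>\<^sup>+t. ennreal ((p t)\<^sup>2) \<partial>haar) = ennreal ((norm (toL2 p))\<^sup>2)"
proof -
  have "(\<integral>\<^sup>+t. ennreal ((p t)\<^sup>2) \<partial>haar) = ennreal (LINT t|haar. (p t)\<^sup>2)"
    using L2_square_integrable[OF assms] by (intro nn_integral_eq_integral) auto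
  also have "(LINT t|haar. (p t)\<^sup>2) = (norm (toL2 p))\<^sup>2"
    unfolding power2_norm_eq_inner using assms
    by (simp add: inner_toL2 L2_inner_def power2_eq_square)
  finally show ?thesis .
qed

text \<open>The Riesz-Fischer argument. The norms of the increments are summable, so the sum of
  their moduli has finite integral and is finite almost everywhere; hence the representatives
  converge almost everywhere. Fatou's lemma turns the Cauchy bound into a bound on the distance to
  the pointwise limit.\<close>

lemma l2_fast_Cauchy_convergent:
  fixes X :: "nat \<Rightarrow> l2"
  assumes X: "Cauchy X" and fast: "\<And>k. norm (X (Suc k) - X k) \<le> (1/2) ^ k"
  shows "convergent X"
proof -
  have "\<forall>k. \<exists>p. p \<in> L2 \<and> toL2 p = X k" by (meson toL2_surj)
  then obtain p where p: "\<And>k. p k \<in> L2" "\<And>k. toL2 (p k) = X k" by metis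
  have [measurable]: "p k \<in> borel_measurable haar" for k
    using p(1) by (rule L2_measurable)
  define u where "u k t = p (Suc k) t - p k t" for k t
  have u: "u k \<in> L2" for k
    unfolding u_def using p(1) by (intro L2_diff)
  have [measurable]: "u k \<in> borel_measurable haar" for k
    using u by (rule L2_measurable)
  have norm_u: "norm (toL2 (u k)) \<le> (1/2) ^ k" for k
    unfolding u_def using fast[of k] p by (simp add: toL2_diff)
  have "(\<integral>\<^sup>+t. (\<Sum>k. ennreal \<bar>u k t\<bar>) \<partial>haar) = (\<Sum>k. \<integral>\<^sup>+t. ennreal \<bar>u k t\<bar> \<partial>haar)"
    by (rule nn_integral_suminf) measurable
  also have "\<dots> = (\<Sum>k. ennreal (LINT t|haar. \<bar>u k t\<bar>))"
    using integrable_abs_L2[OF u] by (intro suminf_cong nn_integral_eq_integral) auto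
  also have "\<dots> \<le> (\<Sum>k. ennreal ((1/2) ^ k))"
    using integral_abs_le_norm[OF u] norm_u
    by (intro suminf_le ennreal_leI summableI) (meson order_trans)
  also have "\<dots> < \<infinity>"
    by (subst suminf_ennreal2) (auto intro: summable_geometric)
  finally have fin: "(\<integral>\<^sup>+t. (\<Sum>k. ennreal \<bar>u k t\<bar>) \<partial>haar) \<noteq> \<infinity>" by simp
  have "AE t in haar. (\<Sum>k. ennreal \<bar>u k t\<bar>) \<noteq> \<infinity>"
    by (rule nn_integral_PInf_AE[OF _ fin]) measurable
  then have conv: "AE t in haar. (\<lambda>n. p n t) \<longlonglongrightarrow> lim (\<lambda>n. p n t)"
  proof eventually_elim
    fix t assume "(\<Sum>k. ennreal \<bar>u k t\<bar>) \<noteq> \<infinity>"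
    then have "summable (\<lambda>k. \<bar>u k t\<bar>)"
      by (intro summable_suminf_not_top) auto
    then have "summable (\<lambda>k. u k t)" by (rule summable_rabs_cancel)
    then have "convergent (\<lambda>n. p n t - p 0 t)"
      unfolding summable_iff_convergent
      by (simp add: u_def sum_lessThan_telescope[of "\<lambda>k. p k t"])
    then have "convergent (\<lambda>n. (p n t - p 0 t) + p 0 t)"
      by (intro convergent_add convergent_const)
    then show "(\<lambda>n. p n t) \<longlonglongrightarrow> lim (\<lambda>n. p n t)"
      by (simp add: convergent_LIMSEQ_iff)
  qed
  define q where "q t = lim (\<lambda>n. p n t)" for t
  have [measurable]: "q \<in> borel_measurable haar"
    unfolding q_def by measurable
  have bound: "\<exists>M. \<forall>k\<ge>M. (\<lambda>t. q t - p k t) \<in> L2 \<and> norm (toL2 (\<lambda>t. q t - p k t)) \<le> e"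
    if "e > 0" for e
  proof -
    obtain M where M: "\<And>j k. j \<ge> M \<Longrightarrow> k \<ge> M \<Longrightarrow> norm (X j - X k) < e"
      using X \<open>e > 0\<close> unfolding Cauchy_iff by blast
    have "(\<lambda>t. q t - p k t) \<in> L2 \<and> norm (toL2 (\<lambda>t. q t - p k t)) \<le> e" if "k \<ge> M" for k
    proof -
      have "(\<integral>\<^sup>+t. ennreal ((q t - p k t)\<^sup>2) \<partial>haar) =
          (\<integral>\<^sup>+t. liminf (\<lambda>j. ennreal ((p j t - p k t)\<^sup>2)) \<partial>haar)"
      proof (rule nn_integral_cong_AE, use conv in eventually_elim)
        fix t assume "(\<lambda>n. p n t) \<longlonglongrightarrow> lim (\<lambda>n. p n t)"
        then have "(\<lambda>j. ennreal ((p j t - p k t)\<^sup>2)) \<longlonglongrightarrow> ennreal ((q t - p k t)\<^sup>2)"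
          unfolding q_def by (intro tendsto_ennrealI tendsto_intros)
        then show "ennreal ((q t - p k t)\<^sup>2) = liminf (\<lambda>j. ennreal ((p j t - p k t)\<^sup>2))"
          by (rule lim_imp_Liminf[OF trivial_limit_sequentially, symmetric])
      qed
      also have "\<dots> \<le> liminf (\<lambda>j. \<integral>\<^sup>+t. ennreal ((p j t - p k t)\<^sup>2) \<partial>haar)"
        by (rule nn_integral_liminf) measurable
      also have "\<dots> = liminf (\<lambda>j. ennreal ((norm (X j - X k))\<^sup>2))"
        using p by (simp add: nn_integral_square_toL2 L2_diff toL2_diff)
      also have "\<dots> \<le> ennreal (e\<^sup>2)"
      proof (rule Liminf_le)
        have "ennreal ((norm (X j - X k))\<^sup>2) \<le> ennreal (e\<^sup>2)" if "j \<ge> M" for j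
          using M[OF that \<open>k \<ge> M\<close>] by (intro ennreal_leI power_mono) auto
        then show "\<forall>\<^sub>F j in sequentially. ennreal ((norm (X j - X k))\<^sup>2) \<le> ennreal (e\<^sup>2)"
          by (auto simp: eventually_sequentially)
      qed simp
      finally have le: "(\<integral>\<^sup>+t. ennreal ((q t - p k t)\<^sup>2) \<partial>haar) \<le> ennreal (e\<^sup>2)" .
      have L2: "(\<lambda>t. q t - p k t) \<in> L2"
      proof (rule L2_I)
        show "integrable haar (\<lambda>t. (q t - p k t)\<^sup>2)"
          using le by (intro integrableI_nonneg) (auto simp: order_le_less_trans)
      qed measurable
      with le have "(norm (toL2 (\<lambda>t. q t - p k t)))\<^sup>2 \<le> e\<^sup>2"
        by (simp add: nn_integral_square_toL2)
      with L2 \<open>e > 0\<close> show ?thesis by (auto intro: power2_le_imp_le)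
    qed
    then show ?thesis by blast
  qed
  \<comment> \<open>One difference in \<open>L2\<close> is enough: adding \<open>p M\<close> back
    puts the limit itself in \<open>L2\<close>.\<close>
  obtain M where "(\<lambda>t. q t - p M t) \<in> L2" using bound[of 1] by auto
  from L2_add[OF this p(1)[of M]] have q: "q \<in> L2" by simp
  have "X \<longlonglongrightarrow> toL2 q"
  proof (rule LIMSEQ_I)
    fix r :: real assume "r > 0"
    then obtain M where M: "\<forall>k\<ge>M. norm (toL2 (\<lambda>t. q t - p k t)) \<le> r / 2"
      using bound[of "r / 2"] by auto
    have "norm (X k - toL2 q) < r" if "k \<ge> M" for k
    proof -
      have "norm (toL2 q - X k) \<le> r / 2" using M that p q by (simp add: toL2_diff)
      then show ?thesis using \<open>r > 0\<close> by (simp add: norm_minus_commute)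
    qed
    then show "\<exists>M. \<forall>k\<ge>M. norm (X k - toL2 q) < r" by blast
  qed
  then show ?thesis by (rule convergentI)
qed

text \<open>A Cauchy sequence converges as soon as one of its subsequences does; dependent choice
  picks a subsequence whose consecutive distances are at most powers of 1/2.\<close>

instance l2 :: complete_space
proof
  fix X :: "nat \<Rightarrow> l2" assume X: "Cauchy X"
  have "\<exists>r. \<forall>k. (\<forall>m\<ge>r k. \<forall>n\<ge>r k. norm (X m - X n) < (1/2) ^ k) \<and> r k < r (Suc k)"
  proof (rule dependent_nat_choice)
    show "\<exists>M. \<forall>m\<ge>M. \<forall>n\<ge>M. norm (X m - X n) < (1/2) ^ 0"
      using X unfolding Cauchy_iff by simp
  next
    fix M k
    have "(0::real) < (1/2) ^ Suc k" by simp
    then obtain M' where "\<forall>m\<ge>M'. \<forall>n\<ge>M'. norm (X m - X n) < (1/2) ^ Suc k"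
      using X unfolding Cauchy_iff by metis
    then show "\<exists>M'. (\<forall>m\<ge>M'. \<forall>n\<ge>M'. norm (X m - X n) < (1/2) ^ Suc k) \<and> M < M'"
      by (intro exI[of _ "max M' (Suc M)"]) auto
  qed
  then obtain r where r: "\<And>k m n. m \<ge> r k \<Longrightarrow> n \<ge> r k \<Longrightarrow> norm (X m - X n) < (1/2) ^ k"
    "\<And>k. r k < r (Suc k)" by blast
  have "strict_mono r" using r(2) by (rule strict_monoI_Suc)
  have "convergent (X \<circ> r)"
  proof (rule l2_fast_Cauchy_convergent)
    show "Cauchy (X \<circ> r)" using X \<open>strict_mono r\<close> by (rule Cauchy_subseq_Cauchy)
    show "norm ((X \<circ> r) (Suc k) - (X \<circ> r) k) \<le> (1/2) ^ k" for k
      using r(1)[of k "r (Suc k)" "r k"] r(2)[of k] by (simp add: less_imp_le)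
  qed
  then obtain l where "(X \<circ> r) \<longlonglongrightarrow> l" by (auto simp: convergent_def)
  with X \<open>strict_mono r\<close> have "X \<longlonglongrightarrow> l" by (rule Cauchy_converges_subseq)
  then show "convergent X" by (rule convergentI)
qed

section \<open>Topology and atomic measures of the torus\<close>

lemma torus_of_cases:
  obtains s where "t = torus_of s"
proof -
  have "\<exists>s. torus_of s = t" by transfer (metis Ints_0 diff_self)
  then show ?thesis using that by blast
qed

lemma torus_of_diff: "torus_of (s - t) = torus_of s - torus_of t"
  by transfer simp

lemma torus_of_zero: "torus_of 0 = 0"
  by transfer simp

lemma continuous_on_torus_iff:
  "continuous_on UNIV f \<longleftrightarrow> continuous_on UNIV (\<lambda>s. f (torus_of s))"
  by (simp add: continuous_on_open_vimage open_torus_def vimage_def)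

lemma closed_torus_iff: "closed C \<longleftrightarrow> closed (torus_of -` C)" for C :: "torus set"
  by (simp add: closed_def open_torus_def vimage_Compl)

text \<open>In the quotient topology closedness is read off preimages, and the preimage of a point
  is a translate of the integers.\<close>

lemma closed_finite_torus:
  fixes F :: "torus set"
  assumes "finite F" shows "closed F"
proof -
  have "closed {t}" for t :: torus
  proof -
    obtain s where s: "t = torus_of s" by (rule torus_of_cases)
    have "torus_of -` {t} = (\<lambda>u. u - s) -` \<int>"
      by (auto simp: s torus_of_eq_iff)
    then show ?thesis
      unfolding closed_torus_iff
      by (auto intro!: continuous_closed_vimage continuous_intros closed_Ints)
  qed
  then have "closed (\<Union>t\<in>F. {t})" using assms by (intro closed_UN) auto
  then show ?thesis by simp
qed

lemma finite_torus_borel: "finite F \<Longrightarrow> F \<in> sets borel" for F :: "torus set"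
  by (simp add: closed_finite_torus borel_closed)

lemma compact_torus: "compact (UNIV :: torus set)"
proof -
  have "t \<in> torus_of ` {0..1}" for t
  proof -
    obtain s where s: "t = torus_of s" by (rule torus_of_cases)
    have "t = torus_of (frac s)" by (simp add: s torus_of_eq_iff frac_def)
    then show ?thesis by (auto simp: less_imp_le frac_lt_1)
  qed
  then have "UNIV = torus_of ` {0..1}" by auto
  then show ?thesis
    using compact_continuous_image[OF continuous_on_subset[OF continuous_on_torus_of], of "{0..1}"]
    by simp
qed

lemma bounded_continuous_torus:
  fixes f :: "torus \<Rightarrow> real"
  assumes "continuous_on UNIV f"
  obtains B where "B > 0" "\<And>t. \<bar>f t\<bar> \<le> B"
proof -
  have "bounded (range f)"
    using compact_continuous_image[OF assms compact_torus] by (rule compact_imp_bounded)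
  then show ?thesis using that unfolding bounded_pos by auto
qed

text \<open>A free index type lets one formula serve both the spikes, indexed by numbers, and the
  measures on a grid, indexed by their own points with \<open>x\<close> the identity.\<close>

definition atomic_measure :: "'i set \<Rightarrow> ('i \<Rightarrow> real) \<Rightarrow> ('i \<Rightarrow> torus) \<Rightarrow> torus set \<Rightarrow> real"
  where "atomic_measure I a x =
    (\<lambda>A. if A \<in> sets borel then \<Sum>i\<in>I. a i * indicator A (x i) else 0)"

lemma discrete_measure_eq_atomic: "discrete_measure N a x = atomic_measure {1..N} a x"
  by (simp only: discrete_measure_def atomic_measure_def)

text \<open>The Hahn decomposition is explicit: the supremum in \<open>pos_part\<close> is attained
  at the atoms of positive weight inside \<open>A\<close>. Injectivity matters, since weights of
  opposite sign at a common point would cancel.\<close>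

lemma pos_part_atomic:
  assumes I: "finite I" and inj: "inj_on x I"
  shows "pos_part (atomic_measure I a x) =
    distr (point_measure I (\<lambda>i. ennreal (max 0 (a i)))) borel x" (is "_ = ?M")
proof -
  have Sup: "(SUP B\<in>{B \<in> sets borel. B \<subseteq> A}. atomic_measure I a x B) =
      (\<Sum>i\<in>I. max 0 (a i) * indicator A (x i))" if A: "A \<in> sets borel" for A
  proof (rule cSup_eq_maximum)
    let ?B = "A \<inter> x ` {i\<in>I. a i > 0}"
    have B: "?B \<in> sets borel"
      using A I by (intro sets.Int finite_torus_borel) auto
    have ind: "a i * indicator ?B (x i) = max 0 (a i) * indicator A (x i)" if "i \<in> I" for i
    proof -
      have "x i \<in> x ` {i\<in>I. a i > 0} \<longleftrightarrow> a i > 0"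
        using inj that by (auto dest: inj_onD)
      then show ?thesis by (auto simp: indicator_def)
    qed
    have "atomic_measure I a x ?B = (\<Sum>i\<in>I. max 0 (a i) * indicator A (x i))"
      unfolding atomic_measure_def using B ind by (simp cong: sum.cong)
    with B show "(\<Sum>i\<in>I. max 0 (a i) * indicator A (x i)) \<in>
        atomic_measure I a x ` {B \<in> sets borel. B \<subseteq> A}"
      by (intro image_eqI[of _ _ ?B]) auto
  next
    fix v assume "v \<in> atomic_measure I a x ` {B \<in> sets borel. B \<subseteq> A}"
    then obtain B where B: "B \<in> sets borel" "B \<subseteq> A" "v = atomic_measure I a x B" by auto
    have "a i * indicator B (x i) \<le> max 0 (a i) * indicator A (x i)" for i
      using B(2) by (auto simp: indicator_def)
    then show "v \<le> (\<Sum>i\<in>I. max 0 (a i) * indicator A (x i))"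
      using B by (simp add: atomic_measure_def sum_mono)
  qed
  have M: "emeasure ?M A = ennreal (SUP B\<in>{B \<in> sets borel. B \<subseteq> A}. atomic_measure I a x B)"
    if A: "A \<in> sets borel" for A
  proof -
    have "emeasure ?M A = (\<Sum>i\<in>x -` A \<inter> I. ennreal (max 0 (a i)))"
      using A I by (simp add: emeasure_distr space_point_measure emeasure_point_measure_finite)
    also have "\<dots> = (\<Sum>i\<in>I. ennreal (max 0 (a i) * indicator A (x i)))"
      using I by (intro sum.mono_neutral_cong_left) (auto simp: indicator_def)
    also have "\<dots> = ennreal (\<Sum>i\<in>I. max 0 (a i) * indicator A (x i))"
      by (rule sum_ennreal) auto
    finally show ?thesis by (simp add: Sup[OF A])
  qed
  have "pos_part (atomic_measure I a x) = measure_of UNIV (sets borel) (emeasure ?M)"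
    unfolding pos_part_def
  proof (rule measure_of_eq)
    show "sets borel \<subseteq> Pow (UNIV :: torus set)" by simp
    fix A :: "torus set"
    assume "A \<in> sigma_sets UNIV (sets borel)"
    then have "A \<in> sets borel"
      using sets.sigma_sets_eq[of "borel :: torus measure"] by simp
    then show "ennreal (SUP B\<in>{B \<in> sets borel. B \<subseteq> A}. atomic_measure I a x B) = emeasure ?M A"
      by (simp add: M)
  qed
  also have "\<dots> = ?M"
    using measure_of_of_measure[of ?M] by simp
  finally show ?thesis .
qed

lemma signed_integral_atomic:
  assumes I: "finite I" and inj: "inj_on x I" and f: "continuous_on UNIV f"
  shows "signed_integral (atomic_measure I a x) f = (\<Sum>i\<in>I. a i * f (x i))"
proof -
  have f: "f \<in> borel_measurable borel" using f by (rule borel_measurable_continuous_onI)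
  have int: "(LINT t|pos_part (atomic_measure I b x). f t) = (\<Sum>i\<in>I. max 0 (b i) * f (x i))" for b
    using I f by (simp add: pos_part_atomic[OF I inj] integral_distr
        lebesgue_integral_point_measure_finite)
  have "(\<lambda>A. - atomic_measure I a x A) = atomic_measure I (\<lambda>i. - a i) x"
    by (simp add: atomic_measure_def fun_eq_iff sum_negf)
  then have "signed_integral (atomic_measure I a x) f =
      (\<Sum>i\<in>I. max 0 (a i) * f (x i)) - (\<Sum>i\<in>I. max 0 (- a i) * f (x i))"
    by (simp add: signed_integral_def int)
  also have "\<dots> = (\<Sum>i\<in>I. a i * f (x i))"
    unfolding sum_subtractf[symmetric] by (rule sum.cong) (auto simp: max_def)
  finally show ?thesis .
qed

lemma atomic_measure_radon:
  assumes "finite I" shows "atomic_measure I a x \<in> radon_measures"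
proof -
  have ind: "(\<lambda>k. indicator (A k) y) sums (indicator (\<Union>k. A k) y :: real)"
    if "disjoint_family A" for A :: "nat \<Rightarrow> torus set" and y
  proof (cases "y \<in> (\<Union>k. A k)")
    case True
    then obtain j where j: "y \<in> A j" by auto
    have "indicator (A k) y = (if k = j then 1 else 0 :: real)" for k
      using j that by (auto simp: indicator_def disjoint_family_on_def)
    then show ?thesis using True sums_single[of j "\<lambda>_. 1::real"] by simp
  next
    case False
    then have "indicator (A k) y = (0 :: real)" for k by auto
    then show ?thesis using False by simp
  qed
  show ?thesis
    unfolding radon_measures_def atomic_measure_def
    by (auto intro!: sums_sum sums_mult ind simp: range_subsetD)
qed

lemma measure_support_atomic:
  assumes "finite I" shows "measure_support (atomic_measure I a x) \<subseteq> x ` I"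
proof
  fix t assume t: "t \<in> measure_support (atomic_measure I a x)"
  show "t \<in> x ` I"
  proof (rule ccontr)
    assume "t \<notin> x ` I"
    moreover have "open (- (x ` I))"
      using assms closed_finite_torus[of "x ` I"] by (auto simp: closed_def)
    ultimately obtain A where A: "A \<subseteq> - (x ` I)" "atomic_measure I a x A \<noteq> 0"
      using t unfolding measure_support_def by auto
    have "(\<Sum>i\<in>I. a i * indicator A (x i)) = 0"
      using A(1) by (intro sum.neutral) (auto simp: indicator_def)
    with A(2) show False by (simp add: atomic_measure_def split: if_splits)
  qed
qed

lemma atomic_measure_singleton:
  assumes "finite G" "t \<in> G" shows "atomic_measure G c (\<lambda>t. t) {t} = c t"
proof -
  have "(\<Sum>s\<in>G. c s * indicator {t} s) = (\<Sum>s\<in>G. if s = t then c s else 0)"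
    by (rule sum.cong) (auto simp: indicator_def)
  then show ?thesis
    using assms by (simp add: atomic_measure_def finite_torus_borel)
qed

section \<open>Finitely supported Radon measures\<close>

lemma radon_measure_empty:
  assumes "m \<in> radon_measures" shows "m {} = 0"
proof -
  \<comment> \<open>The empty sets form a disjoint family with empty union, and a constant series
    converges only if its term is 0.\<close>
  have "(\<lambda>i::nat. m {}) sums m {}"
    using assms unfolding radon_measures_def
    by (auto simp: disjoint_family_on_def dest!: spec[of _ "\<lambda>_. {}"])
  then have "summable (\<lambda>i::nat. m {})" by (rule sums_summable)
  then show ?thesis by (simp add: summable_const_iff)
qed

lemma radon_measure_Un:
  assumes m: "m \<in> radon_measures" and "A \<in> sets borel" "B \<in> sets borel" "A \<inter> B = {}"
  shows "m (A \<union> B) = m A + m B"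
proof -
  have "range (binaryset A B) \<subseteq> sets borel"
    using assms by (auto simp: range_binaryset_eq)
  moreover have "disjoint_family (binaryset A B)"
    using assms by (auto simp: disjoint_family_on_def binaryset_def)
  ultimately have "(\<lambda>i. m (binaryset A B i)) sums m (\<Union>i. binaryset A B i)"
    using m unfolding radon_measures_def by blast
  moreover have "(\<lambda>i. m (binaryset A B i)) sums (m A + m B)"
    using radon_measure_empty[OF m] by (rule binaryset_sums)
  ultimately show ?thesis by (simp add: UN_binaryset_eq sums_unique2)
qed

lemma radon_measure_finite:
  assumes m: "m \<in> radon_measures" and "finite F" shows "m F = (\<Sum>t\<in>F. m {t})"
  using \<open>finite F\<close>
proof induction
  case (insert t F)
  then have "m ({t} \<union> F) = m {t} + m F"
    by (intro radon_measure_Un[OF m] finite_torus_borel) auto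
  with insert show ?case by simp
qed (simp add: radon_measure_empty[OF m])

text \<open>Each point off the support has an open neighbourhood all of whose Borel subsets have
  mass 0. Uncountably many neighbourhoods may be involved, so a countable subcover is extracted
  before countable additivity is used. Since masses are signed, it is mass 0 on all subsets that
  survives making the cover disjoint.\<close>

lemma radon_measure_null_off_support:
  assumes m: "m \<in> radon_measures" and A: "A \<in> sets borel" "A \<inter> measure_support m = {}"
  shows "m A = 0"
proof -
  define null where "null U \<longleftrightarrow> open U \<and> (\<forall>B\<in>sets borel. B \<subseteq> U \<longrightarrow> m B = 0)" for U
  \<comment> \<open>Preimages are taken because the Lindelof property is applied on the real
    line.\<close>
  define F where "F = {torus_of -` U | U. null U}"
  have "open V" if "V \<in> F" for V
    using that by (auto simp: F_def null_def open_torus_def)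
  then obtain F' where F': "F' \<subseteq> F" "countable F'" "\<Union>F' = \<Union>F" by (rule Lindelof)
  \<comment> \<open>The empty set is adjoined so that \<open>from_nat_into\<close> enumerates a
    nonempty family even when \<open>F'\<close> is empty.\<close>
  have "{} \<in> F"
    unfolding F_def null_def using radon_measure_empty[OF m] by (auto intro!: exI[of _ "{}"])
  then have "from_nat_into (insert {} F') k \<in> F" for k :: nat
    using F' from_nat_into[of "insert {} F'" k] by auto
  then have "\<forall>k. \<exists>U. null U \<and> from_nat_into (insert {} F') k = torus_of -` U"
    unfolding F_def by blast
  then have "\<exists>U. \<forall>k. null (U k) \<and> from_nat_into (insert {} F') k = torus_of -` U k"
    by (rule choice)
  then obtain U where "\<forall>k. null (U k) \<and> from_nat_into (insert {} F') k = torus_of -` U k" ..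
  then have U: "null (U k)" "from_nat_into (insert {} F') k = torus_of -` U k" for k
    by simp_all
  have cover: "A \<subseteq> (\<Union>k. U k)"
  proof
    fix t assume "t \<in> A"
    with A(2) have "t \<notin> measure_support m" by auto
    then obtain V where V: "null V" "t \<in> V"
      unfolding measure_support_def null_def by auto
    obtain s where s: "t = torus_of s" by (rule torus_of_cases)
    have "s \<in> \<Union>F" using V s by (auto simp: F_def)
    then obtain W where W: "W \<in> F'" "s \<in> W" using F'(3) by auto
    then obtain k where "from_nat_into (insert {} F') k = W"
      using F'(2) from_nat_into_surj[of "insert {} F'" W] by auto
    with U(2)[of k] W s show "t \<in> (\<Union>k. U k)" by auto
  qed
  have U_borel: "U k \<in> sets borel" for k
    using U(1) by (auto simp: null_def)
  define D where "D k = A \<inter> disjointed U k" for k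
  have D_borel: "D k \<in> sets borel" for k
    unfolding D_def using A(1) U_borel sets.range_disjointed_sets[of U borel] by auto
  have "disjoint_family D"
    using disjoint_family_disjointed[of U] by (auto simp: D_def disjoint_family_on_def)
  moreover have "(\<Union>k. D k) = A"
    using cover UN_disjointed_eq[of U] by (auto simp: D_def)
  ultimately have "(\<lambda>k. m (D k)) sums m A"
    using m D_borel unfolding radon_measures_def by auto
  moreover have "m (D k) = 0" for k
    using U(1)[of k] D_borel[of k] disjointed_subset[of U k] unfolding null_def D_def by blast
  ultimately show ?thesis by (simp add: sums_iff)
qed

text \<open>Borel sets off the finite set have mass 0, so the point masses determine the measure.
  This turns the minimization over measures into one over finitely many coefficients.\<close>

lemma radon_measure_eq_atomic:
  assumes m: "m \<in> radon_measures" and G: "finite G" "measure_support m \<subseteq> G"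
  shows "m = atomic_measure G (\<lambda>t. m {t}) (\<lambda>t. t)"
proof
  fix A
  show "m A = atomic_measure G (\<lambda>t. m {t}) (\<lambda>t. t) A"
  proof (cases "A \<in> sets borel")
    case False
    then show ?thesis using m by (simp add: atomic_measure_def radon_measures_def)
  next
    case True
    have fin: "finite (A \<inter> G)" using G by simp
    have "m A = m ((A \<inter> G) \<union> (A - G))" by (rule arg_cong[of _ _ m]) auto
    also have "\<dots> = m (A \<inter> G) + m (A - G)"
      using True G(1) by (intro radon_measure_Un[OF m]) (auto intro: finite_torus_borel)
    also have "m (A - G) = 0"
      using True G by (intro radon_measure_null_off_support[OF m])
        (auto intro: finite_torus_borel)
    also have "m (A \<inter> G) = (\<Sum>t\<in>A \<inter> G. m {t})"
      using fin by (rule radon_measure_finite[OF m])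
    also have "\<dots> = (\<Sum>t\<in>G. m {t} * indicator A t)"
      using G(1) by (intro sum.mono_neutral_cong_left) (auto simp: indicator_def)
    finally show ?thesis using True by (simp add: atomic_measure_def)
  qed
qed

lemma measure_support_subset_atoms:
  assumes m: "m \<in> radon_measures" and G: "finite G" "measure_support m \<subseteq> G"
  shows "measure_support m \<subseteq> {t\<in>G. m {t} \<noteq> 0}"
proof -
  have "m = atomic_measure G (\<lambda>t. m {t}) (\<lambda>t. t)"
    using assms by (rule radon_measure_eq_atomic)
  also have "\<dots> = atomic_measure {t\<in>G. m {t} \<noteq> 0} (\<lambda>t. m {t}) (\<lambda>t. t)"
    unfolding atomic_measure_def using G(1)
    by (intro ext if_cong refl sum.mono_neutral_right) auto
  finally have "measure_support m =
      measure_support (atomic_measure {t\<in>G. m {t} \<noteq> 0} (\<lambda>t. m {t}) (\<lambda>t. t))" by simp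
  also have "\<dots> \<subseteq> (\<lambda>t. t) ` {t\<in>G. m {t} \<noteq> 0}"
    using G(1) by (intro measure_support_atomic) simp
  finally show ?thesis by simp
qed

section \<open>Translates of the kernel\<close>

lemma norm_toL2_le:
  assumes p: "p \<in> L2" and B: "\<And>t. \<bar>p t\<bar> \<le> B"
  shows "norm (toL2 p) \<le> B"
proof -
  have B0: "0 \<le> B" using B[of undefined] by linarith
  have const: "(\<lambda>t. B) \<in> L2" using L2_scale[OF L2_one, of B] by simp
  have "(norm (toL2 p))\<^sup>2 = (LINT t|haar. (p t)\<^sup>2)"
    unfolding power2_norm_eq_inner using p by (simp add: inner_toL2 L2_inner_def power2_eq_square)
  also have "\<dots> \<le> (LINT t|haar. B\<^sup>2)"
    using p const B B0 by (intro integral_mono L2_square_integrable)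
      (auto simp: abs_le_square_iff[symmetric])
  also have "\<dots> = B\<^sup>2"
    by (simp add: measure_def emeasure_haar_UNIV)
  finally show ?thesis using B0 by (rule power2_le_imp_le)
qed

lemma continuous_torus_L2:
  assumes "continuous_on UNIV f" shows "f \<in> L2"
proof -
  obtain B where B: "\<And>t. \<bar>f t\<bar> \<le> B" using bounded_continuous_torus[OF assms] by blast
  have f [measurable]: "f \<in> borel_measurable haar"
    using assms by (simp add: measurable_haar_eq borel_measurable_continuous_onI)
  have "AE t in haar. norm ((f t)\<^sup>2) \<le> B\<^sup>2"
    using B by (auto simp: abs_le_square_iff[symmetric] intro!: order_trans[OF B])
  then have "integrable haar (\<lambda>t. (f t)\<^sup>2)"
    by (rule haar.integrable_const_bound) measurable
  with f show ?thesis by (rule L2_I)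
qed

text \<open>The Riesz representer of evaluation at \<open>t\<close>: the value
  \<open>conv_adj \<psi> p t\<close> is its inner product with the class of \<open>p\<close>. It is
  also the class of the image of a unit Dirac mass at \<open>t\<close> under
  \<open>conv_op \<psi>\<close>.\<close>

definition kernel_at :: "(torus \<Rightarrow> real) \<Rightarrow> torus \<Rightarrow> l2"
  where "kernel_at \<psi> t = toL2 (\<lambda>x. \<psi> (t - x))"

lemma continuous_on_reflect_torus:
  fixes \<psi> :: "torus \<Rightarrow> real"
  assumes "continuous_on UNIV \<psi>"
  shows "continuous_on UNIV (\<lambda>x. \<psi> (t - x))" and "continuous_on UNIV (\<lambda>x. \<psi> (x - t))"
proof -
  obtain r where r: "t = torus_of r" by (rule torus_of_cases)
  have *: "continuous_on UNIV (\<lambda>s. \<psi> (torus_of s))"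
    using assms by (simp add: continuous_on_torus_iff)
  have "continuous_on UNIV (\<lambda>s. \<psi> (torus_of (r - s)))"
    "continuous_on UNIV (\<lambda>s. \<psi> (torus_of (s - r)))"
    by (intro continuous_on_compose2[OF *] continuous_intros; simp)+
  then show "continuous_on UNIV (\<lambda>x. \<psi> (t - x))" "continuous_on UNIV (\<lambda>x. \<psi> (x - t))"
    by (simp_all add: continuous_on_torus_iff r torus_of_diff)
qed

lemmas L2_reflect = continuous_torus_L2[OF continuous_on_reflect_torus(1)]

lemma conv_adj_eq_inner:
  assumes "continuous_on UNIV \<psi>" "p \<in> L2"
  shows "conv_adj \<psi> p t = inner (kernel_at \<psi> t) (toL2 p)"
  using assms by (simp add: conv_adj_def kernel_at_def inner_toL2 L2_reflect L2_inner_def)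

lemma uniformly_continuous_torus:
  fixes \<psi> :: "torus \<Rightarrow> real"
  assumes "continuous_on UNIV \<psi>" "e > 0"
  obtains d where "d > 0" "\<And>s z. \<bar>s\<bar> < d \<Longrightarrow> \<bar>\<psi> (z + torus_of s) - \<psi> z\<bar> < e"
proof -
  \<comment> \<open>A representative in [0,1] moved by less than 1 stays in [-1,2], so uniform
    continuity on this interval covers the torus.\<close>
  have "continuous_on {-1..2} (\<lambda>s. \<psi> (torus_of s))"
    using assms continuous_on_subset by (simp add: continuous_on_torus_iff) blast
  then have "uniformly_continuous_on {-1..2} (\<lambda>s. \<psi> (torus_of s))"
    by (rule compact_uniformly_continuous) simp
  then obtain d where d: "d > 0" "\<And>s t. s \<in> {-1..2} \<Longrightarrow> t \<in> {-1..2} \<Longrightarrow> dist t s < d \<Longrightarrow>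
      dist (\<psi> (torus_of t)) (\<psi> (torus_of s)) < e"
    unfolding uniformly_continuous_on_def using \<open>e > 0\<close> by metis
  have "\<bar>\<psi> (z + torus_of s) - \<psi> z\<bar> < e" if "\<bar>s\<bar> < min d 1" for s z
  proof -
    obtain r where r: "z = torus_of r" by (rule torus_of_cases)
    obtain v where v: "0 \<le> v" "v \<le> 1" "z = torus_of v"
    proof
      show "z = torus_of (frac r)" by (simp add: r torus_of_eq_iff frac_def)
      show "0 \<le> frac r" "frac r \<le> 1" by (simp_all add: less_imp_le frac_lt_1)
    qed
    have "dist (\<psi> (torus_of (v + s))) (\<psi> (torus_of v)) < e"
      using that v by (intro d(2)) (auto simp: dist_real_def)
    then show ?thesis by (simp add: v dist_real_def torus_of_add)
  qed
  moreover have "min d 1 > 0" using d by simp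
  ultimately show ?thesis using that by blast
qed

lemma torus_deriv_has_derivative:
  assumes "torus_differentiable \<psi>"
  shows "((\<lambda>s. \<psi> (z + torus_of s)) has_real_derivative torus_deriv \<psi> (z + torus_of u)) (at u)"
proof -
  have "(\<lambda>s. \<psi> (z + torus_of u + torus_of s)) differentiable (at 0)"
    using assms by (auto simp: torus_differentiable_def)
  then have "((\<lambda>s. \<psi> (z + torus_of u + torus_of s)) has_real_derivative
      torus_deriv \<psi> (z + torus_of u)) (at 0)"
    unfolding torus_deriv_def by (simp add: DERIV_deriv_iff_real_differentiable)
  then have "((\<lambda>s. \<psi> (z + torus_of (u + s))) has_real_derivative
      torus_deriv \<psi> (z + torus_of u)) (at 0)"
    by (simp add: torus_of_add add.assoc)
  then show ?thesis
    using DERIV_at_within_shift_lemma[of "\<lambda>s. \<psi> (z + torus_of s)" _ u 0 UNIV]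
      DERIV_shift[of "\<lambda>s. \<psi> (z + torus_of s)" _ 0 u] by (simp add: add.commute)
qed

lemma torus_differentiable_continuous:
  assumes "torus_differentiable \<psi>" shows "continuous_on UNIV \<psi>"
  unfolding continuous_on_torus_iff
  using torus_deriv_has_derivative[OF assms, of 0] DERIV_isCont
  by (auto intro!: continuous_at_imp_continuous_on simp: torus_of_zero)

text \<open>By the mean value theorem the remainder is \<open>s\<close> times an increment of the
  derivative, which uniform continuity makes small. A single \<open>d\<close> for all
  \<open>z\<close> gives a sup bound, hence a bound in the norm of \<open>l2\<close>.\<close>

lemma torus_taylor_uniform:
  assumes diff: "torus_differentiable \<psi>" and cont: "continuous_on UNIV (torus_deriv \<psi>)"
    and "e > 0"
  obtains d where "d > 0"
    "\<And>s z. \<bar>s\<bar> < d \<Longrightarrow> \<bar>\<psi> (z + torus_of s) - \<psi> z - s * torus_deriv \<psi> z\<bar> \<le> e * \<bar>s\<bar>"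
proof -
  obtain d where d: "d > 0"
    "\<And>s z. \<bar>s\<bar> < d \<Longrightarrow> \<bar>torus_deriv \<psi> (z + torus_of s) - torus_deriv \<psi> z\<bar> < e"
    using uniformly_continuous_torus[OF cont \<open>e > 0\<close>] by blast
  have "\<bar>\<psi> (z + torus_of s) - \<psi> z - s * torus_deriv \<psi> z\<bar> \<le> e * \<bar>s\<bar>" if "\<bar>s\<bar> < d" for s z
  proof -
    have "\<exists>\<xi>. \<bar>\<xi>\<bar> \<le> \<bar>s\<bar> \<and> \<psi> (z + torus_of s) - \<psi> z = s * torus_deriv \<psi> (z + torus_of \<xi>)"
    proof (cases s "0 :: real" rule: linorder_cases)
      case less
      then obtain \<xi> where "\<xi> > s" "\<xi> < 0"
        "\<psi> (z + torus_of 0) - \<psi> (z + torus_of s) = (0 - s) * torus_deriv \<psi> (z + torus_of \<xi>)"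
        using MVT2[of s 0 "\<lambda>s. \<psi> (z + torus_of s)" "\<lambda>s. torus_deriv \<psi> (z + torus_of s)"]
          torus_deriv_has_derivative[OF diff] by blast
      then show ?thesis by (intro exI[of _ \<xi>]) (auto simp: torus_of_zero algebra_simps)
    next
      case equal
      then show ?thesis by (intro exI[of _ 0]) (simp add: torus_of_zero)
    next
      case greater
      then obtain \<xi> where "\<xi> > 0" "\<xi> < s"
        "\<psi> (z + torus_of s) - \<psi> (z + torus_of 0) = (s - 0) * torus_deriv \<psi> (z + torus_of \<xi>)"
        using MVT2[of 0 s "\<lambda>s. \<psi> (z + torus_of s)" "\<lambda>s. torus_deriv \<psi> (z + torus_of s)"]
          torus_deriv_has_derivative[OF diff] by blast
      then show ?thesis by (intro exI[of _ \<xi>]) (auto simp: torus_of_zero)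
    qed
    then obtain \<xi> where \<xi>: "\<bar>\<xi>\<bar> \<le> \<bar>s\<bar>"
      "\<psi> (z + torus_of s) - \<psi> z = s * torus_deriv \<psi> (z + torus_of \<xi>)" by blast
    then have "\<bar>\<psi> (z + torus_of s) - \<psi> z - s * torus_deriv \<psi> z\<bar> =
        \<bar>torus_deriv \<psi> (z + torus_of \<xi>) - torus_deriv \<psi> z\<bar> * \<bar>s\<bar>"
      by (simp add: abs_mult[symmetric] algebra_simps)
    also have "\<dots> \<le> e * \<bar>s\<bar>"
      using d(2)[of \<xi> z] \<xi>(1) that by (intro mult_right_mono) auto
    finally show ?thesis .
  qed
  with d show ?thesis using that by blast
qed

text \<open>Differentiating the representer itself, in norm, makes the derivatives of a certificate
  inner products of its vector with the kernels of the derivatives of \<psi>. Norm convergence of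
  the vectors thereby controls the second derivatives too.\<close>

lemma kernel_at_has_derivative:
  assumes diff: "torus_differentiable \<psi>" and cont: "continuous_on UNIV (torus_deriv \<psi>)"
  shows "((\<lambda>s. kernel_at \<psi> (t + torus_of s)) has_derivative
    (\<lambda>h. h *\<^sub>R kernel_at (torus_deriv \<psi>) (t + torus_of u))) (at u)"
  unfolding has_derivative_at_alt
proof (intro conjI allI impI)
  show "bounded_linear (\<lambda>h. h *\<^sub>R kernel_at (torus_deriv \<psi>) (t + torus_of u))"
    by (rule bounded_linear_scaleR_left)
  fix e :: real assume "e > 0"
  then obtain d where d: "d > 0"
    "\<And>s z. \<bar>s\<bar> < d \<Longrightarrow> \<bar>\<psi> (z + torus_of s) - \<psi> z - s * torus_deriv \<psi> z\<bar> \<le> e * \<bar>s\<bar>"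
    using torus_taylor_uniform[OF diff cont] by blast
  note cont\<psi> = torus_differentiable_continuous[OF diff]
  have "norm (kernel_at \<psi> (t + torus_of v) - kernel_at \<psi> (t + torus_of u) -
      (v - u) *\<^sub>R kernel_at (torus_deriv \<psi>) (t + torus_of u)) \<le> e * norm (v - u)"
    if "norm (v - u) < d" for v
  proof -
    have shift: "t + torus_of v - x = t + torus_of u - x + torus_of (v - u)" for x
      by (simp add: torus_of_diff)
    have "kernel_at \<psi> (t + torus_of v) - kernel_at \<psi> (t + torus_of u) -
        (v - u) *\<^sub>R kernel_at (torus_deriv \<psi>) (t + torus_of u) =
        toL2 (\<lambda>x. \<psi> (t + torus_of v - x) - \<psi> (t + torus_of u - x) -
          (v - u) * torus_deriv \<psi> (t + torus_of u - x))"
      unfolding kernel_at_def using cont cont\<psi>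
      by (simp add: toL2_diff toL2_scale L2_diff L2_scale L2_reflect)
    also have "norm \<dots> \<le> e * norm (v - u)"
    proof (rule norm_toL2_le)
      show "(\<lambda>x. \<psi> (t + torus_of v - x) - \<psi> (t + torus_of u - x) -
          (v - u) * torus_deriv \<psi> (t + torus_of u - x)) \<in> L2"
        using cont cont\<psi> by (intro L2_diff L2_scale L2_reflect)
      show "\<bar>\<psi> (t + torus_of v - x) - \<psi> (t + torus_of u - x) -
          (v - u) * torus_deriv \<psi> (t + torus_of u - x)\<bar> \<le> e * norm (v - u)" for x
        using d(2)[of "v - u" "t + torus_of u - x"] that unfolding shift[of x] by simp
    qed
    finally show ?thesis .
  qed
  with \<open>d > 0\<close> show "\<exists>d>0. \<forall>v. norm (v - u) < d \<longrightarrow>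
      norm (kernel_at \<psi> (t + torus_of v) - kernel_at \<psi> (t + torus_of u) -
        (v - u) *\<^sub>R kernel_at (torus_deriv \<psi>) (t + torus_of u)) \<le> e * norm (v - u)"
    by blast
qed

lemma inner_kernel_has_derivative:
  assumes "torus_differentiable \<psi>" "continuous_on UNIV (torus_deriv \<psi>)"
  shows "((\<lambda>s. inner (kernel_at \<psi> (t + torus_of s)) P) has_real_derivative
    inner (kernel_at (torus_deriv \<psi>) (t + torus_of u)) P) (at u)"
  using bounded_linear.has_derivative[OF bounded_linear_inner_left
      kernel_at_has_derivative[OF assms]]
  by (simp add: has_field_derivative_def mult_commute_abs)

lemma torus_deriv_inner_kernel:
  assumes "torus_differentiable \<psi>" "continuous_on UNIV (torus_deriv \<psi>)"
  shows "torus_deriv (\<lambda>t. inner (kernel_at \<psi> t) P) = (\<lambda>t. inner (kernel_at (torus_deriv \<psi>) t) P)"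
  unfolding torus_deriv_def[of "\<lambda>t. inner (kernel_at \<psi> t) P"]
  using inner_kernel_has_derivative[OF assms, of _ P 0]
  by (intro ext DERIV_imp_deriv) (simp add: torus_of_zero)

lemma continuous_on_kernel_at:
  assumes cont: "continuous_on UNIV \<psi>"
  shows "continuous_on UNIV (\<lambda>s. kernel_at \<psi> (t + torus_of s))"
  unfolding continuous_on_iff
proof (intro ballI allI impI)
  fix u e :: real assume "e > 0"
  then obtain d where d: "d > 0" "\<And>s z. \<bar>s\<bar> < d \<Longrightarrow> \<bar>\<psi> (z + torus_of s) - \<psi> z\<bar> < e / 2"
    using uniformly_continuous_torus[OF cont, of "e / 2"] by auto
  have "dist (kernel_at \<psi> (t + torus_of v)) (kernel_at \<psi> (t + torus_of u)) < e"
    if "dist v u < d" for v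
  proof -
    have shift: "t + torus_of v - x = t + torus_of u - x + torus_of (v - u)" for x
      by (simp add: torus_of_diff)
    have "kernel_at \<psi> (t + torus_of v) - kernel_at \<psi> (t + torus_of u) =
        toL2 (\<lambda>x. \<psi> (t + torus_of v - x) - \<psi> (t + torus_of u - x))"
      unfolding kernel_at_def using cont by (simp add: toL2_diff L2_reflect)
    also have "norm \<dots> \<le> e / 2"
    proof (rule norm_toL2_le)
      show "(\<lambda>x. \<psi> (t + torus_of v - x) - \<psi> (t + torus_of u - x)) \<in> L2"
        using cont by (intro L2_diff L2_reflect)
      show "\<bar>\<psi> (t + torus_of v - x) - \<psi> (t + torus_of u - x)\<bar> \<le> e / 2" for x
        using d(2)[of "v - u" "t + torus_of u - x"] that unfolding shift[of x]
        by (simp add: dist_real_def)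
    qed
    finally show ?thesis using \<open>e > 0\<close> by (simp add: dist_norm)
  qed
  with \<open>d > 0\<close> show "\<exists>d>0. \<forall>v\<in>UNIV. dist v u < d \<longrightarrow>
      dist (kernel_at \<psi> (t + torus_of v)) (kernel_at \<psi> (t + torus_of u)) < e" by blast
qed

lemma norm_kernel_at_bound:
  assumes cont: "continuous_on UNIV \<psi>"
  obtains B where "B > 0" "\<And>t. norm (kernel_at \<psi> t) \<le> B"
proof -
  obtain B where B: "B > 0" "\<And>t. \<bar>\<psi> t\<bar> \<le> B" using bounded_continuous_torus[OF cont] by blast
  have "norm (kernel_at \<psi> t) \<le> B" for t
    unfolding kernel_at_def using B L2_reflect[OF cont] by (intro norm_toL2_le)
  with B(1) show ?thesis by (rule that)
qed

section \<open>Dyadic grids and one-dimensional calculus\<close>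

lemma finite_grid: "finite (grid n)"
  unfolding grid_def by (simp add: setcompr_eq_image atMost_def[symmetric])

lemma torus_of_int_grid: "torus_of (of_int k / 2 ^ n) \<in> grid n"
proof -
  define j where "j = nat (k mod 2 ^ n)"
  have j: "int j = k mod 2 ^ n" by (simp add: j_def)
  have "int j < 2 ^ n" unfolding j by simp
  then have "int j < int (2 ^ n)" by simp
  then have "j < 2 ^ n" by (simp only: of_nat_less_iff)
  have "k = 2 ^ n * (k div 2 ^ n) + int j" by (simp add: j)
  then have "real_of_int k = of_int (2 ^ n * (k div 2 ^ n) + int j)" by simp
  then have "of_int k / 2 ^ n - real j / 2 ^ n = of_int (k div 2 ^ n)"
    by (simp add: field_simps)
  then have "torus_of (of_int k / 2 ^ n) = torus_of (real j / 2 ^ n)"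
    by (simp add: torus_of_eq_iff)
  then show ?thesis using \<open>j < 2 ^ n\<close> unfolding grid_def by auto
qed

text \<open>Without the bound on the index the grid is visibly a subgroup of the torus, and
  refinements and shifts need no wrap-around.\<close>

lemma grid_eq: "grid n = {torus_of (of_int k / 2 ^ n) | k. True}"
proof
  show "grid n \<subseteq> {torus_of (of_int k / 2 ^ n) | k. True}"
    unfolding grid_def by (auto intro: exI[of _ "int _"])
qed (auto simp: torus_of_int_grid)

lemma grid_mono: "m \<le> n \<Longrightarrow> grid m \<subseteq> grid n"
proof
  fix t assume "m \<le> n" "t \<in> grid m"
  then obtain k :: int where k: "t = torus_of (of_int k / 2 ^ m)" by (auto simp: grid_eq)
  obtain d where "n = m + d" using \<open>m \<le> n\<close> le_Suc_ex by blast
  then have "of_int k / 2 ^ m = (of_int (k * 2 ^ d) :: real) / 2 ^ n"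
    by (simp add: power_add)
  then show "t \<in> grid n" unfolding k using torus_of_int_grid by metis
qed

lemma grid_add: "t \<in> grid n \<Longrightarrow> t + torus_of (of_int k / 2 ^ n) \<in> grid n"
proof -
  assume "t \<in> grid n"
  then obtain j :: int where "t = torus_of (of_int j / 2 ^ n)" by (auto simp: grid_eq)
  then have "t + torus_of (of_int k / 2 ^ n) = torus_of (of_int (j + k) / 2 ^ n)"
    by (simp add: torus_of_add add_divide_distrib)
  then show ?thesis by (simp add: torus_of_int_grid del: of_int_add)
qed

text \<open>The displacement is known only modulo integers, but an integer is itself a multiple of
  the grid step.\<close>

lemma grid_diff:
  assumes "t \<in> grid n" "t + torus_of u \<in> grid n"
  obtains k :: int where "u = of_int k / 2 ^ n"
proof -
  obtain i j :: int where "t = torus_of (of_int i / 2 ^ n)"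
    "t + torus_of u = torus_of (of_int j / 2 ^ n)"
    using assms by (auto simp: grid_eq)
  then have "of_int i / 2 ^ n + u - of_int j / 2 ^ n \<in> (\<int> :: real set)"
    by (metis torus_of_add torus_of_eq_iff)
  then obtain l :: int where "of_int i / 2 ^ n + u - of_int j / 2 ^ n = (of_int l :: real)"
    by (auto elim: Ints_cases)
  then have "u = of_int l + of_int j / 2 ^ n - of_int i / 2 ^ n" by linarith
  also have "\<dots> = of_int (l * 2 ^ n + j - i) / 2 ^ n"
    by (simp add: add_divide_distrib diff_divide_distrib)
  finally have "u = of_int (l * 2 ^ n + j - i) / 2 ^ n" .
  then show ?thesis by (rule that)
qed

text \<open>Rounding down to a multiple of the grid step approximates every point by grid points.
  This later identifies the intersection of the grid faces with the face of the whole torus.\<close>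

lemma grid_dense_bound:
  fixes f :: "torus \<Rightarrow> real"
  assumes cont: "continuous_on UNIV f" and bound: "\<And>n t. n \<ge> n0 \<Longrightarrow> t \<in> grid n \<Longrightarrow> f t \<le> B"
  shows "f t \<le> B"
proof -
  obtain s where s: "t = torus_of s" by (rule torus_of_cases)
  define q :: "nat \<Rightarrow> real" where "q n = of_int \<lfloor>2 ^ n * s\<rfloor> / 2 ^ n" for n
  have "q \<longlonglongrightarrow> s"
  proof (rule LIMSEQ_I)
    fix e :: real assume "e > 0"
    obtain M where M: "(1/2::real) ^ M < e"
      using real_arch_pow_inv[OF \<open>e > 0\<close>, of "1/2"] by auto
    have "norm (q n - s) < e" if "n \<ge> M" for n
    proof -
      have "\<bar>of_int \<lfloor>2 ^ n * s\<rfloor> - 2 ^ n * s\<bar> \<le> 1" by linarith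
      moreover have "q n - s = (of_int \<lfloor>2 ^ n * s\<rfloor> - 2 ^ n * s) / 2 ^ n"
        by (simp add: q_def field_simps)
      ultimately have "\<bar>q n - s\<bar> \<le> 1 / 2 ^ n" by (simp add: abs_divide divide_right_mono)
      also have "1 / 2 ^ n \<le> (1/2::real) ^ M"
        using that by (simp add: power_one_over divide_simps)
      finally show ?thesis using M by simp
    qed
    then show "\<exists>M. \<forall>n\<ge>M. norm (q n - s) < e" by blast
  qed
  moreover have "isCont (\<lambda>s. f (torus_of s)) s"
    using cont by (simp add: continuous_on_torus_iff continuous_on_eq_continuous_at)
  ultimately have "(\<lambda>n. f (torus_of (q n))) \<longlonglongrightarrow> f (torus_of s)"
    by (rule isCont_tendsto_compose[rotated])
  moreover have "f (torus_of (q n)) \<le> B" if "n \<ge> n0" for n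
    using bound[OF that] torus_of_int_grid by (simp add: q_def)
  ultimately show ?thesis unfolding s by (intro LIMSEQ_le_const2) auto
qed

text \<open>The squared sine descends to a continuous function on the torus that vanishes only
  at 0; products of its translates separate finitely many points.\<close>

lemma torus_interpolation:
  assumes "finite I" "inj_on x I" and v: "\<And>i. i \<in> I \<Longrightarrow> \<bar>v i\<bar> \<le> 1"
  obtains \<psi> :: "torus \<Rightarrow> real"
  where "continuous_on UNIV \<psi>" "\<And>t. \<bar>\<psi> t\<bar> \<le> 1" "\<And>i. i \<in> I \<Longrightarrow> \<psi> (x i) = v i"
proof -
  define D where "D t = (sin (pi * rep_torus t))\<^sup>2" for t
  have D: "D (torus_of s) = (sin (pi * s))\<^sup>2" for s
  proof -
    have "torus_of (rep_torus (torus_of s)) = torus_of s"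
      unfolding torus_of_def by (simp add: Quotient3_abs_rep[OF Quotient3_torus])
    then obtain k :: int where "rep_torus (torus_of s) = s + of_int k"
      unfolding torus_of_eq_iff by (auto elim!: Ints_cases simp: algebra_simps)
    then have "sin (pi * rep_torus (torus_of s)) = sin (pi * s) * cos (pi * of_int k)"
      by (simp add: distrib_left sin_add sin_int_times_real mult.commute)
    moreover have "(cos (pi * of_int k))\<^sup>2 = 1"
      using sin_cos_squared_add[of "pi * of_int k"] sin_int_times_real[of k]
      by (simp add: mult.commute)
    ultimately show ?thesis by (simp add: D_def power_mult_distrib)
  qed
  have D_cont: "continuous_on UNIV (\<lambda>t. D (t - z))" for z
  proof -
    obtain r where r: "z = torus_of r" by (rule torus_of_cases)
    show ?thesis
      by (simp add: continuous_on_torus_iff r torus_of_diff[symmetric] D)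
        (intro continuous_intros)
  qed
  have D_zero: "D t = 0 \<longleftrightarrow> t = 0" for t
  proof -
    obtain s where s: "t = torus_of s" by (rule torus_of_cases)
    have "sin (pi * s) = 0 \<longleftrightarrow> s \<in> \<int>"
      by (auto simp: sin_zero_iff_int2 Ints_def)
    then show ?thesis
      by (simp add: s D torus_of_zero[symmetric] torus_of_eq_iff)
  qed
  \<comment> \<open>Lagrange interpolation, with \<open>D\<close> of a difference in place of the
    linear factor.\<close>
  define L where "L t = (\<Sum>i\<in>I. v i * (\<Prod>j\<in>I - {i}. D (t - x j) / D (x i - x j)))" for t
  have L_cont: "continuous_on UNIV L"
    unfolding L_def divide_inverse by (intro continuous_intros D_cont)
  have L_val: "L (x k) = v k" if "k \<in> I" for k
  proof -
    have "(\<Prod>j\<in>I - {i}. D (x k - x j) / D (x i - x j)) = (if i = k then 1 else 0)"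
      if "i \<in> I" for i
    proof (cases "i = k")
      case True
      have "D (x k - x j) \<noteq> 0" if "j \<in> I - {k}" for j
        using that \<open>inj_on x I\<close> \<open>k \<in> I\<close> by (auto simp: D_zero dest: inj_onD)
      then show ?thesis using True by (simp add: prod.neutral)
    next
      case False
      then have "k \<in> I - {i}" "D (x k - x k) / D (x i - x k) = 0"
        using \<open>k \<in> I\<close> by (auto simp: D_zero)
      then show ?thesis using False \<open>finite I\<close>
        by (metis (no_types, lifting) finite_Diff prod_zero)
    qed
    then have "L (x k) = (\<Sum>i\<in>I. if i = k then v i else 0)"
      unfolding L_def by (intro sum.cong) auto
    then show ?thesis using that \<open>finite I\<close> by simp
  qed
  show ?thesis
  proof
    \<comment> \<open>Clipping to [-1,1] enforces the bound and leaves the prescribed values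
      unchanged, as they already lie in that interval.\<close>
    show "continuous_on UNIV (\<lambda>t. max (- 1) (min 1 (L t)))"
      by (intro continuous_intros L_cont)
    show "\<bar>max (- 1) (min 1 (L t))\<bar> \<le> 1" for t by auto
    show "max (- 1) (min 1 (L (x i))) = v i" if "i \<in> I" for i
      using v[OF that] by (simp add: L_val that)
  qed
qed

lemma open_torus_nbhd: "open {z + torus_of u | u. \<bar>u\<bar> < r}"
proof -
  obtain \<xi> where \<xi>: "z = torus_of \<xi>" by (rule torus_of_cases)
  have "torus_of -` {z + torus_of u | u. \<bar>u\<bar> < r} = (\<Union>k\<in>\<int>. ball (\<xi> + k) r)"
  proof (intro equalityI subsetI)
    fix s assume "s \<in> torus_of -` {z + torus_of u | u. \<bar>u\<bar> < r}"
    then obtain u where u: "\<bar>u\<bar> < r" "torus_of s = torus_of (\<xi> + u)"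
      by (auto simp: \<xi> torus_of_add)
    then have "s - (\<xi> + u) \<in> \<int>" by (simp add: torus_of_eq_iff)
    moreover have "s \<in> ball (\<xi> + (s - (\<xi> + u))) r"
      using u(1) by (simp add: dist_real_def)
    ultimately show "s \<in> (\<Union>k\<in>\<int>. ball (\<xi> + k) r)" by blast
  next
    fix s assume "s \<in> (\<Union>k\<in>\<int>. ball (\<xi> + k) r)"
    then obtain k where k: "k \<in> \<int>" "\<bar>s - (\<xi> + k)\<bar> < r" by (auto simp: dist_real_def abs_minus_commute)
    then have "torus_of s = torus_of (\<xi> + (s - (\<xi> + k)))"
      unfolding torus_of_eq_iff by simp
    then have "torus_of s = z + torus_of (s - (\<xi> + k))" by (simp only: torus_of_add \<xi>)
    with k(2) show "s \<in> torus_of -` {z + torus_of u | u. \<bar>u\<bar> < r}" by blast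
  qed
  then show ?thesis unfolding open_torus_def by auto
qed

section \<open>Second derivative tests on the line\<close>

lemma neg_second_derivative_interior:
  fixes f f' f'' :: "real \<Rightarrow> real"
  assumes f: "\<And>s. (f has_real_derivative f' s) (at s)"
    and f': "\<And>s. (f' has_real_derivative f'' s) (at s)"
    and neg: "\<And>s. u < s \<Longrightarrow> s < w \<Longrightarrow> f'' s < 0"
    and "u < v" "v < w"
  shows "f u < f v \<or> f w < f v"
proof (rule ccontr)
  \<comment> \<open>Otherwise \<open>f'\<close> is nonpositive somewhere before \<open>v\<close> and
    nonnegative somewhere after it, which contradicts \<open>f'' < 0\<close> in between.\<close>
  assume *: "\<not> ?thesis"
  obtain p where p: "u < p" "p < v" "f v - f u = (v - u) * f' p"
    using MVT2[OF \<open>u < v\<close>, of f f'] f by blast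
  obtain q where q: "v < q" "q < w" "f w - f v = (w - v) * f' q"
    using MVT2[OF \<open>v < w\<close>, of f f'] f by blast
  have "f' p \<le> 0"
    using * p \<open>u < v\<close> by (smt (verit) mult_pos_pos)
  moreover have "0 \<le> f' q"
    using * q \<open>v < w\<close> by (smt (verit) mult_pos_neg)
  moreover have "p < q" using p q by linarith
  then obtain z where z: "p < z" "z < q" "f' q - f' p = (q - p) * f'' z"
    using MVT2[of p q f' f''] f' by blast
  moreover have "f'' z < 0" using neg[of z] z p q by linarith
  ultimately show False using \<open>p < q\<close> by (smt (verit) mult_pos_neg)
qed

lemma local_max_second_derivative:
  fixes f f' :: "real \<Rightarrow> real"
  assumes f: "\<And>s. (f has_real_derivative f' s) (at s)"
    and f': "(f' has_real_derivative l) (at 0)"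
    and max: "\<And>s. f s \<le> f 0"
  shows "l \<le> 0"
proof (rule ccontr)
  assume "\<not> l \<le> 0"
  have "f' 0 = 0"
    using DERIV_local_max[OF f[of 0], of 1] max by auto
  \<comment> \<open>As \<open>f'\<close> vanishes at 0 with positive slope, it is positive just to
    the right, and \<open>f\<close> would climb above its maximum.\<close>
  obtain d where d: "d > 0" "\<And>h. h > 0 \<Longrightarrow> h < d \<Longrightarrow> f' 0 < f' (0 + h)"
    using DERIV_pos_inc_right[OF f'] \<open>\<not> l \<le> 0\<close> by auto
  obtain p where p: "0 < p" "p < d / 2" "f (d / 2) - f 0 = (d / 2 - 0) * f' p"
    using MVT2[of 0 "d / 2" f f'] f d(1) by auto
  have "0 < (d / 2 - 0) * f' p" using d p \<open>f' 0 = 0\<close> by auto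
  with p max[of "d / 2"] show False by linarith
qed

section \<open>First-order optimality for penalized least squares\<close>

lemma nonneg_of_quadratic_bound:
  fixes A B :: real
  assumes "d > 0" and bound: "\<And>s. 0 < s \<Longrightarrow> s < d \<Longrightarrow> 0 \<le> s * A + s\<^sup>2 * B"
  shows "0 \<le> A"
proof (rule ccontr)
  assume "\<not> 0 \<le> A"
  \<comment> \<open>The first entry keeps \<open>s\<close> below \<open>d\<close>; the second makes
    \<open>s * \<bar>B\<bar>\<close> less than half of \<open>- A\<close>, with the summand 1
    guarding against \<open>B = 0\<close>.\<close>
  define s where "s = min (d / 2) (- A / (2 * (\<bar>B\<bar> + 1)))"
  have s: "0 < s" "s < d"
    using \<open>\<not> 0 \<le> A\<close> \<open>d > 0\<close> unfolding s_def by (auto simp: divide_less_0_iff)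
  have "s * (2 * (\<bar>B\<bar> + 1)) \<le> - A"
  proof -
    have "s \<le> - A / (2 * (\<bar>B\<bar> + 1))" unfolding s_def by simp
    then show ?thesis by (subst (asm) pos_le_divide_eq) auto
  qed
  then have "2 * (s * \<bar>B\<bar>) + 2 * s \<le> - A" by (simp add: algebra_simps)
  moreover have "s * B \<le> s * \<bar>B\<bar>" using s by (intro mult_left_mono) auto
  ultimately have "A + s * B < 0" using s \<open>\<not> 0 \<le> A\<close> by linarith
  then have "s * (A + s * B) < 0" using s by (simp add: mult_pos_neg)
  with bound[OF s] show False by (simp add: power2_eq_square algebra_simps)
qed

text \<open>One coefficient is moved by \<open>s\<close>. The quadratic part changes by
  \<open>- s * g\<close> up to second order, and the penalty by at most
  \<open>lam * \<bar>s\<bar>\<close>, which bounds \<open>g\<close>. If \<open>c t\<close> is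
  nonzero, moving it towards 0 without crossing lowers the penalty linearly, and this gives the
  reverse inequality.\<close>

lemma lasso_optimality:
  fixes k :: "'t \<Rightarrow> 'a::real_inner"
  assumes "finite G" "t \<in> G" "lam > 0"
    and opt: "\<And>c'. 1/2 * (norm ((\<Sum>t\<in>G. c t *\<^sub>R k t) - y))\<^sup>2 + lam * (\<Sum>t\<in>G. \<bar>c t\<bar>)
      \<le> 1/2 * (norm ((\<Sum>t\<in>G. c' t *\<^sub>R k t) - y))\<^sup>2 + lam * (\<Sum>t\<in>G. \<bar>c' t\<bar>)"
  defines "g \<equiv> inner (k t) (y - (\<Sum>t\<in>G. c t *\<^sub>R k t))"
  shows "\<bar>g\<bar> \<le> lam" "c t \<noteq> 0 \<Longrightarrow> g = lam * sgn (c t)"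
proof -
  define M where "M = (\<Sum>t\<in>G. c t *\<^sub>R k t)"
  define B where "B = (norm (k t))\<^sup>2 / 2"
  have var: "0 \<le> lam * (\<bar>c t + s\<bar> - \<bar>c t\<bar>) - s * g + s\<^sup>2 * B" for s
  proof -
    define c' where "c' = c(t := c t + s)"
    have "(\<Sum>u\<in>G. c' u *\<^sub>R k u) = c' t *\<^sub>R k t + (\<Sum>u\<in>G - {t}. c' u *\<^sub>R k u)"
      using assms by (intro sum.remove)
    also have "(\<Sum>u\<in>G - {t}. c' u *\<^sub>R k u) = (\<Sum>u\<in>G - {t}. c u *\<^sub>R k u)"
      by (rule sum.cong) (auto simp: c'_def)
    also have "c' t *\<^sub>R k t + \<dots> = M + s *\<^sub>R k t"
      using assms unfolding M_def sum.remove[OF \<open>finite G\<close> \<open>t \<in> G\<close>]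
      by (simp add: c'_def scaleR_add_left)
    finally have M': "(\<Sum>u\<in>G. c' u *\<^sub>R k u) = M + s *\<^sub>R k t" .
    have "(\<Sum>u\<in>G. \<bar>c' u\<bar>) = \<bar>c' t\<bar> + (\<Sum>u\<in>G - {t}. \<bar>c' u\<bar>)"
      using assms by (intro sum.remove)
    also have "(\<Sum>u\<in>G - {t}. \<bar>c' u\<bar>) = (\<Sum>u\<in>G - {t}. \<bar>c u\<bar>)"
      by (rule sum.cong) (auto simp: c'_def)
    also have "\<bar>c' t\<bar> + \<dots> = (\<Sum>u\<in>G. \<bar>c u\<bar>) + (\<bar>c t + s\<bar> - \<bar>c t\<bar>)"
      using assms unfolding sum.remove[OF \<open>finite G\<close> \<open>t \<in> G\<close>] by (simp add: c'_def)
    finally have S': "(\<Sum>u\<in>G. \<bar>c' u\<bar>) = (\<Sum>u\<in>G. \<bar>c u\<bar>) + (\<bar>c t + s\<bar> - \<bar>c t\<bar>)" .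
    have "(norm (M + s *\<^sub>R k t - y))\<^sup>2 = (norm (M - y))\<^sup>2 - 2 * s * g + s\<^sup>2 * (norm (k t))\<^sup>2"
      unfolding power2_norm_eq_inner g_def M_def[symmetric]
      by (simp add: algebra_simps inner_commute power2_eq_square)
    then show ?thesis
      using opt[of c'] unfolding M' S' M_def[symmetric] B_def
      by (simp add: algebra_simps)
  qed
  have up: "g \<le> lam"
  proof -
    have "0 \<le> s * (lam - g) + s\<^sup>2 * B" if "s > 0" for s
    proof -
      have "lam * (\<bar>c t + s\<bar> - \<bar>c t\<bar>) \<le> lam * s"
        using that \<open>lam > 0\<close> by (intro mult_left_mono) auto
      with var[of s] show ?thesis by (simp add: algebra_simps)
    qed
    then have "0 \<le> lam - g"
      by (metis nonneg_of_quadratic_bound zero_less_one)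
    then show ?thesis by simp
  qed
  have low: "- lam \<le> g"
  proof -
    have "0 \<le> s * (lam + g) + s\<^sup>2 * B" if "s > 0" for s
    proof -
      have "lam * (\<bar>c t - s\<bar> - \<bar>c t\<bar>) \<le> lam * s"
        using that \<open>lam > 0\<close> by (intro mult_left_mono) auto
      with var[of "- s"] show ?thesis by (simp add: algebra_simps)
    qed
    then have "0 \<le> lam + g"
      by (metis nonneg_of_quadratic_bound zero_less_one)
    then show ?thesis by simp
  qed
  show "\<bar>g\<bar> \<le> lam" using up low by linarith
  assume "c t \<noteq> 0"
  show "g = lam * sgn (c t)"
  proof (cases "c t > 0")
    case True
    have "0 \<le> s * (g - lam) + s\<^sup>2 * B" if "0 < s" "s < c t" for s
      using var[of "- s"] that by (simp add: algebra_simps)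
    then have "0 \<le> g - lam"
      using nonneg_of_quadratic_bound[OF True] by blast
    then show ?thesis using up True by simp
  next
    case False
    have "0 \<le> s * (- lam - g) + s\<^sup>2 * B" if "0 < s" "s < - c t" for s
      using var[of s] that by (simp add: algebra_simps)
    moreover have "0 < - c t" using False \<open>c t \<noteq> 0\<close> by simp
    ultimately have "0 \<le> - lam - g" using nonneg_of_quadratic_bound by blast
    then show ?thesis using low False \<open>c t \<noteq> 0\<close> by simp
  qed
qed

section \<open>Dual problems\<close>

lemma toL2_sum:
  assumes "finite I" "\<And>i. i \<in> I \<Longrightarrow> f i \<in> L2"
  shows "(\<lambda>t. \<Sum>i\<in>I. f i t) \<in> L2" "toL2 (\<lambda>t. \<Sum>i\<in>I. f i t) = (\<Sum>i\<in>I. toL2 (f i))"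
proof -
  have "(\<lambda>t. \<Sum>i\<in>I. f i t) \<in> L2 \<and> toL2 (\<lambda>t. \<Sum>i\<in>I. f i t) = (\<Sum>i\<in>I. toL2 (f i))"
    using assms
  proof induction
    case empty
    then show ?case by (simp add: L2_zero toL2_zero)
  next
    case (insert i I)
    then show ?case by (simp add: L2_add toL2_add)
  qed
  then show "(\<lambda>t. \<Sum>i\<in>I. f i t) \<in> L2"
    "toL2 (\<lambda>t. \<Sum>i\<in>I. f i t) = (\<Sum>i\<in>I. toL2 (f i))" by auto
qed

lemma conv_op_atomic:
  assumes cont: "continuous_on UNIV \<phi>" and I: "finite I" "inj_on z I"
  shows "conv_op \<phi> (atomic_measure I c z) \<in> L2"
    "toL2 (conv_op \<phi> (atomic_measure I c z)) = (\<Sum>i\<in>I. c i *\<^sub>R kernel_at \<phi> (z i))"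
proof -
  have eq: "conv_op \<phi> (atomic_measure I c z) = (\<lambda>t. \<Sum>i\<in>I. c i * \<phi> (z i - t))"
    using signed_integral_atomic[OF I continuous_on_reflect_torus(2)[OF cont]]
    by (simp add: conv_op_def fun_eq_iff)
  have L2: "(\<lambda>t. c i * \<phi> (z i - t)) \<in> L2" for i
    by (intro L2_scale L2_reflect cont)
  show "conv_op \<phi> (atomic_measure I c z) \<in> L2"
    unfolding eq using I(1) L2 by (rule toL2_sum)
  have "toL2 (\<lambda>t. \<Sum>i\<in>I. c i * \<phi> (z i - t)) = (\<Sum>i\<in>I. toL2 (\<lambda>t. c i * \<phi> (z i - t)))"
    using I(1) L2 by (rule toL2_sum)
  also have "\<dots> = (\<Sum>i\<in>I. c i *\<^sub>R kernel_at \<phi> (z i))"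
    by (simp add: kernel_at_def toL2_scale L2_reflect[OF cont])
  finally show "toL2 (conv_op \<phi> (atomic_measure I c z)) = (\<Sum>i\<in>I. c i *\<^sub>R kernel_at \<phi> (z i))"
    unfolding eq .
qed

text \<open>The zero measure has a finite value, so a minimizer avoids the infinite penalty and is
  carried by the grid. It is then compared with the atomic measures on the grid, whose values depend
  on the coefficients alone.\<close>

lemma primal_solution_gridD:
  assumes cont: "continuous_on UNIV \<phi>" and y: "y \<in> L2" and "lam > 0"
    and m: "primal_solution_grid \<phi> n lam y m"
  shows "m \<in> radon_measures" "measure_support m \<subseteq> grid n"
    "1/2 * (norm ((\<Sum>t\<in>grid n. m {t} *\<^sub>R kernel_at \<phi> t) - toL2 y))\<^sup>2
        + lam * (\<Sum>t\<in>grid n. \<bar>m {t}\<bar>)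
      \<le> 1/2 * (norm ((\<Sum>t\<in>grid n. c t *\<^sub>R kernel_at \<phi> t) - toL2 y))\<^sup>2
        + lam * (\<Sum>t\<in>grid n. \<bar>c t\<bar>)"
proof -
  define J where "J m = ereal (1 / 2 * (L2_norm (\<lambda>t. conv_op \<phi> m t - y t))\<^sup>2)
    + ereal lam * tv_norm_grid n m" for m
  define A where "A c = atomic_measure (grid n) c (\<lambda>t. t)" for c
  have J_A: "J (A c) = ereal (1/2 * (norm ((\<Sum>t\<in>grid n. c t *\<^sub>R kernel_at \<phi> t) - toL2 y))\<^sup>2
      + lam * (\<Sum>t\<in>grid n. \<bar>c t\<bar>))" for c
  proof -
    have "measure_support (A c) \<subseteq> grid n"
      using measure_support_atomic[OF finite_grid] by (auto simp: A_def)
    then have "tv_norm_grid n (A c) = ereal (\<Sum>t\<in>grid n. \<bar>c t\<bar>)"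
      by (simp add: tv_norm_grid_def A_def atomic_measure_singleton finite_grid)
    moreover have "L2_norm (\<lambda>t. conv_op \<phi> (A c) t - y t) =
        norm ((\<Sum>t\<in>grid n. c t *\<^sub>R kernel_at \<phi> t) - toL2 y)"
      using y conv_op_atomic[OF cont finite_grid, of "\<lambda>t. t" n c]
      by (simp add: A_def norm_toL2[symmetric] toL2_diff L2_diff)
    ultimately show ?thesis by (simp add: J_def)
  qed
  have rad: "m \<in> radon_measures" and min: "J m \<le> J m'" if "m' \<in> radon_measures" for m'
    using m that unfolding primal_solution_grid_def is_arg_min_def J_def
    by (auto simp: not_less)
  have A_rad: "A c \<in> radon_measures" for c
    unfolding A_def by (rule atomic_measure_radon[OF finite_grid])
  show rad: "m \<in> radon_measures" by (rule rad[OF A_rad])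
  show supp: "measure_support m \<subseteq> grid n"
  proof (rule ccontr)
    assume "\<not> ?thesis"
    then have "J m = \<infinity>" using \<open>lam > 0\<close> by (simp add: J_def tv_norm_grid_def)
    with min[OF A_rad[of "\<lambda>_. 0"]] show False unfolding J_A by simp
  qed
  have "m = A (\<lambda>t. m {t})"
    unfolding A_def using rad finite_grid supp by (rule radon_measure_eq_atomic)
  then have "J (A (\<lambda>t. m {t})) \<le> J (A c)" using min[OF A_rad[of c]] by simp
  then show "1/2 * (norm ((\<Sum>t\<in>grid n. m {t} *\<^sub>R kernel_at \<phi> t) - toL2 y))\<^sup>2
        + lam * (\<Sum>t\<in>grid n. \<bar>m {t}\<bar>)
      \<le> 1/2 * (norm ((\<Sum>t\<in>grid n. c t *\<^sub>R kernel_at \<phi> t) - toL2 y))\<^sup>2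
        + lam * (\<Sum>t\<in>grid n. \<bar>c t\<bar>)"
    unfolding J_A by simp
qed

text \<open>The dual constraint carried over to classes, an intersection of closed slabs.\<close>

definition dual_ball :: "(torus \<Rightarrow> real) \<Rightarrow> torus set \<Rightarrow> l2 set"
  where "dual_ball \<phi> S = {P. \<forall>t\<in>S. \<bar>inner (kernel_at \<phi> t) P\<bar> \<le> 1}"

lemma closed_dual_ball: "closed (dual_ball \<phi> S)"
proof -
  have "dual_ball \<phi> S = (\<Inter>t\<in>S. {P. \<bar>inner (kernel_at \<phi> t) P\<bar> \<le> 1})"
    by (auto simp: dual_ball_def)
  then show ?thesis
    by (auto intro!: closed_INT closed_Collect_le continuous_intros)
qed

lemma convex_dual_ball: "convex (dual_ball \<phi> S)"
proof (rule convexI)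
  fix P Q :: l2 and u v :: real
  assume *: "P \<in> dual_ball \<phi> S" "Q \<in> dual_ball \<phi> S" "0 \<le> u" "0 \<le> v" "u + v = 1"
  have "\<bar>u * inner (kernel_at \<phi> t) P + v * inner (kernel_at \<phi> t) Q\<bar> \<le> 1" if "t \<in> S" for t
  proof -
    have "\<bar>u * inner (kernel_at \<phi> t) P + v * inner (kernel_at \<phi> t) Q\<bar> \<le>
        u * \<bar>inner (kernel_at \<phi> t) P\<bar> + v * \<bar>inner (kernel_at \<phi> t) Q\<bar>"
      using * by (intro order_trans[OF abs_triangle_ineq]) (simp add: abs_mult)
    also have "\<dots> \<le> u * 1 + v * 1"
      using * that by (intro add_mono mult_left_mono) (auto simp: dual_ball_def)
    finally show ?thesis using * by simp
  qed
  then show "u *\<^sub>R P + v *\<^sub>R Q \<in> dual_ball \<phi> S"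
    by (simp add: dual_ball_def inner_add_right)
qed

text \<open>The dyadic hypothesis and the source condition stay outside the locale. They enter its
  lemmas as the inclusion of the spikes in \<open>S\<close> and as the nonemptiness of a
  face.\<close>

locale spikes =
  fixes \<phi> :: "torus \<Rightarrow> real" and N :: nat and a :: "nat \<Rightarrow> real" and x :: "nat \<Rightarrow> torus"
  assumes phi_C2: "C2_torus \<phi>"
    and a_nonzero: "\<And>i. i \<in> {1..N} \<Longrightarrow> a i \<noteq> 0"
    and x_distinct: "inj_on x {1..N}"
begin

definition y0 :: "torus \<Rightarrow> real"
  where "y0 = conv_op \<phi> (discrete_measure N a x)"

definition Y0 :: l2
  where "Y0 = (\<Sum>i\<in>{1..N}. a i *\<^sub>R kernel_at \<phi> (x i))"

text \<open>If \<open>S\<close> contains the spikes and this set is nonempty, it is the face of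
  \<open>dual_ball \<phi> S\<close> on which \<open>Y0\<close> is maximal, that is, the solution set
  of the dual problem.\<close>

definition dual_face :: "torus set \<Rightarrow> l2 set"
  where "dual_face S = {P \<in> dual_ball \<phi> S. \<forall>i\<in>{1..N}. inner (kernel_at \<phi> (x i)) P = sgn (a i)}"

lemma phi_diff: "torus_differentiable \<phi>" "torus_differentiable (torus_deriv \<phi>)"
  and phi_cont: "continuous_on UNIV \<phi>" "continuous_on UNIV (torus_deriv \<phi>)"
    "continuous_on UNIV (torus_deriv (torus_deriv \<phi>))"
  using phi_C2 by (auto simp: C2_torus_def torus_differentiable_continuous)

lemma y0_L2: "y0 \<in> L2" and toL2_y0: "toL2 y0 = Y0"
  using conv_op_atomic[OF phi_cont(1) _ x_distinct, of a]
  by (auto simp: y0_def Y0_def discrete_measure_eq_atomic)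

lemma inner_Y0: "inner Y0 P = (\<Sum>i\<in>{1..N}. a i * inner (kernel_at \<phi> (x i)) P)"
  by (simp add: Y0_def inner_sum_left)

lemma sgn_abs_a: "i \<in> {1..N} \<Longrightarrow> \<bar>sgn (a i)\<bar> = 1"
  using a_nonzero by (simp add: abs_sgn_eq)

text \<open>The bound holds term by term, so equality of the sums forces equality in every term;
  dividing by the nonzero \<open>a i\<close> yields the sign.\<close>

lemma inner_Y0_le:
  assumes "x ` {1..N} \<subseteq> S" "P \<in> dual_ball \<phi> S"
  shows "inner Y0 P \<le> (\<Sum>i\<in>{1..N}. \<bar>a i\<bar>)"
    and "inner Y0 P = (\<Sum>i\<in>{1..N}. \<bar>a i\<bar>) \<longleftrightarrow> P \<in> dual_face S"
proof -
  have le: "a i * inner (kernel_at \<phi> (x i)) P \<le> \<bar>a i\<bar>" if "i \<in> {1..N}" for i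
  proof -
    have "x i \<in> S" using assms(1) that by blast
    then have "\<bar>a i * inner (kernel_at \<phi> (x i)) P\<bar> \<le> \<bar>a i\<bar> * 1"
      unfolding abs_mult using assms(2) by (intro mult_left_mono) (auto simp: dual_ball_def)
    then show ?thesis by simp
  qed
  then show "inner Y0 P \<le> (\<Sum>i\<in>{1..N}. \<bar>a i\<bar>)"
    unfolding inner_Y0 by (rule sum_mono)
  have "inner Y0 P = (\<Sum>i\<in>{1..N}. \<bar>a i\<bar>) \<longleftrightarrow>
      (\<forall>i\<in>{1..N}. a i * inner (kernel_at \<phi> (x i)) P = \<bar>a i\<bar>)"
  proof
    assume eq: "inner Y0 P = (\<Sum>i\<in>{1..N}. \<bar>a i\<bar>)"
    then have "(\<Sum>i\<in>{1..N}. \<bar>a i\<bar> - a i * inner (kernel_at \<phi> (x i)) P) = 0"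
      by (simp add: inner_Y0 sum_subtractf)
    then show "\<forall>i\<in>{1..N}. a i * inner (kernel_at \<phi> (x i)) P = \<bar>a i\<bar>"
      using le by (subst (asm) sum_nonneg_eq_0_iff) auto
  qed (simp add: inner_Y0)
  also have "\<dots> \<longleftrightarrow> (\<forall>i\<in>{1..N}. inner (kernel_at \<phi> (x i)) P = sgn (a i))"
  proof (rule ball_cong)
    fix i assume "i \<in> {1..N}"
    then have "a i \<noteq> 0" by (rule a_nonzero)
    moreover have "a i * sgn (a i) = \<bar>a i\<bar>" by (simp add: abs_sgn)
    ultimately show "a i * inner (kernel_at \<phi> (x i)) P = \<bar>a i\<bar> \<longleftrightarrow>
        inner (kernel_at \<phi> (x i)) P = sgn (a i)"
      by (metis mult_left_cancel)
  qed simp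
  finally show "inner Y0 P = (\<Sum>i\<in>{1..N}. \<bar>a i\<bar>) \<longleftrightarrow> P \<in> dual_face S"
    using assms by (simp add: dual_face_def)
qed

lemma closed_dual_face: "closed (dual_face S)"
proof -
  have "dual_face S = dual_ball \<phi> S \<inter>
      (\<Inter>i\<in>{1..N}. {P. inner (kernel_at \<phi> (x i)) P = sgn (a i)})"
    by (auto simp: dual_face_def)
  then show ?thesis
    by (auto intro!: closed_Int closed_dual_ball closed_INT closed_Collect_eq continuous_intros)
qed

lemma convex_dual_face: "convex (dual_face S)"
proof (rule convexI)
  fix P Q :: l2 and u v :: real
  assume *: "P \<in> dual_face S" "Q \<in> dual_face S" "0 \<le> u" "0 \<le> v" "u + v = 1"
  then have "u *\<^sub>R P + v *\<^sub>R Q \<in> dual_ball \<phi> S"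
    using convexD[OF convex_dual_ball] by (auto simp: dual_face_def)
  moreover have "u * sgn (a i) + v * sgn (a i) = sgn (a i)" for i
    using * by (simp add: distrib_right[symmetric])
  ultimately show "u *\<^sub>R P + v *\<^sub>R Q \<in> dual_face S"
    using * by (simp add: dual_face_def inner_add_right)
qed

lemma dual_face_antimono: "S \<subseteq> T \<Longrightarrow> dual_face T \<subseteq> dual_face S"
  by (auto simp: dual_face_def dual_ball_def)

text \<open>A nonempty face means that the bound of \<open>inner_Y0_le\<close> is attained, so the
  maximizers are exactly the feasible vectors attaining it.\<close>

lemma dual_solutions_iff:
  assumes S: "x ` {1..N} \<subseteq> S" and ne: "dual_face S \<noteq> {}"
  shows "p \<in> dual_solutions \<phi> S y0 \<longleftrightarrow> p \<in> L2 \<and> toL2 p \<in> dual_face S"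
proof -
  have feas: "q \<in> dual_feasible \<phi> S \<longleftrightarrow> q \<in> L2 \<and> toL2 q \<in> dual_ball \<phi> S" for q
    by (auto simp: dual_feasible_def dual_ball_def conv_adj_eq_inner[OF phi_cont(1)])
  have val: "L2_inner y0 q = inner Y0 (toL2 q)" if "q \<in> L2" for q
    using that by (simp add: inner_toL2[symmetric] y0_L2 toL2_y0)
  obtain P where P: "P \<in> dual_face S" using ne by auto
  obtain p0 where p0: "p0 \<in> L2" "toL2 p0 = P" by (rule toL2_surj)
  have P_ball: "P \<in> dual_ball \<phi> S" using P by (simp add: dual_face_def)
  have P_val: "inner Y0 P = (\<Sum>i\<in>{1..N}. \<bar>a i\<bar>)" using inner_Y0_le(2)[OF S P_ball] P by simp
  show ?thesis
  proof
    assume "p \<in> dual_solutions \<phi> S y0"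
    then have p: "p \<in> L2" "toL2 p \<in> dual_ball \<phi> S" and max: "\<not> L2_inner y0 p < L2_inner y0 p0"
      using p0 P_ball by (auto simp: dual_solutions_def is_arg_max_def feas)
    then have "inner Y0 P \<le> inner Y0 (toL2 p)" using p0 by (simp add: val not_less)
    with P_val inner_Y0_le[OF S p(2)] p show "p \<in> L2 \<and> toL2 p \<in> dual_face S" by auto
  next
    assume p: "p \<in> L2 \<and> toL2 p \<in> dual_face S"
    then have ball: "toL2 p \<in> dual_ball \<phi> S" by (simp add: dual_face_def)
    with p have "inner Y0 (toL2 p) = (\<Sum>i\<in>{1..N}. \<bar>a i\<bar>)" using inner_Y0_le(2)[OF S] by simp
    then show "p \<in> dual_solutions \<phi> S y0"
      using p ball inner_Y0_le(1)[OF S]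
      by (auto simp: dual_solutions_def is_arg_max_def feas val not_less)
  qed
qed

text \<open>Since a minimal vector exists, the function chosen by \<open>SOME\<close> is a minimizer
  too, and its certificate depends only on its class.\<close>

lemma certificate_min_norm:
  assumes S: "x ` {1..N} \<subseteq> S" and ne: "dual_face S \<noteq> {}"
  obtains P where "P \<in> dual_face S" "\<And>Q. Q \<in> dual_face S \<Longrightarrow> norm P \<le> norm Q"
    "\<And>t. certificate \<phi> S y0 t = inner (kernel_at \<phi> t) P"
proof -
  obtain Q where Q: "Q \<in> dual_face S" "\<And>R. R \<in> dual_face S \<Longrightarrow> norm Q \<le> norm R"
    using min_norm_exists[OF convex_dual_face closed_dual_face ne] by blast
  obtain q where q: "q \<in> L2" "toL2 q = Q" by (rule toL2_surj)
  define p where "p = min_norm_solution \<phi> S y0"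
  note sol = dual_solutions_iff[OF S ne]
  have "is_arg_min L2_norm (\<lambda>p. p \<in> dual_solutions \<phi> S y0) q"
    using q Q by (auto simp: is_arg_min_def sol not_less norm_toL2[symmetric])
  then have "is_arg_min L2_norm (\<lambda>p. p \<in> dual_solutions \<phi> S y0) p"
    unfolding p_def min_norm_solution_def
    by (rule someI[of "is_arg_min L2_norm (\<lambda>p. p \<in> dual_solutions \<phi> S y0)"])
  then have p: "p \<in> L2" "toL2 p \<in> dual_face S" and le: "L2_norm p \<le> L2_norm q"
    using q Q by (auto simp: is_arg_min_def sol not_less)
  have "norm (toL2 p) \<le> norm R" if "R \<in> dual_face S" for R
    using le Q(2)[OF that] p q by (simp add: norm_toL2[symmetric])
  moreover have "certificate \<phi> S y0 t = inner (kernel_at \<phi> t) (toL2 p)" for t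
    unfolding certificate_def p_def[symmetric] using phi_cont(1) p(1) by (rule conv_adj_eq_inner)
  ultimately show ?thesis using p(2) that by blast
qed

text \<open>A continuous function of modulus at most 1 with the prescribed signs at the spikes shows
  that the total variation is at least the sum of the \<open>\<bar>a i\<bar>\<close>. The vector
  behind \<eta> thus attains the upper bound of \<open>inner_Y0_le\<close>.\<close>

lemma source_condition_dual_face:
  assumes "\<eta> \<in> conv_adj \<phi> ` L2" "\<eta> \<in> tv_subdifferential (discrete_measure N a x)"
  shows "dual_face UNIV \<noteq> {}"
proof -
  let ?m = "discrete_measure N a x"
  obtain p where p: "p \<in> L2" "\<eta> = conv_adj \<phi> p" using assms(1) by auto
  have \<eta>: "continuous_on UNIV \<eta>" "\<And>t. \<bar>\<eta> t\<bar> \<le> 1" "signed_integral ?m \<eta> = tv_norm ?m"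
    using assms(2) by (auto simp: tv_subdifferential_def)
  have \<eta>_eq: "\<eta> t = inner (kernel_at \<phi> t) (toL2 p)" for t
    using p by (simp add: conv_adj_eq_inner[OF phi_cont(1)])
  have int: "signed_integral ?m \<psi> = (\<Sum>i\<in>{1..N}. a i * \<psi> (x i))" if "continuous_on UNIV \<psi>" for \<psi>
    unfolding discrete_measure_eq_atomic using x_distinct that
    by (intro signed_integral_atomic) auto
  obtain \<psi> where \<psi>: "continuous_on UNIV \<psi>" "\<And>t. \<bar>\<psi> t\<bar> \<le> 1"
    "\<And>i. i \<in> {1..N} \<Longrightarrow> \<psi> (x i) = sgn (a i)"
    using torus_interpolation[OF _ x_distinct, of "\<lambda>i. sgn (a i)"]
    by (auto simp: abs_sgn_eq)
  let ?T = "{signed_integral ?m \<psi> | \<psi>. continuous_on UNIV \<psi> \<and> (\<forall>x. \<bar>\<psi> x\<bar> \<le> 1)}"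
  \<comment> \<open>The supremum in \<open>tv_norm\<close> is taken in the reals, so it dominates
    its elements only once the set is known to be bounded.\<close>
  have bdd: "bdd_above ?T"
  proof (rule bdd_aboveI[of _ "\<Sum>i\<in>{1..N}. \<bar>a i\<bar>"])
    fix v assume "v \<in> ?T"
    then obtain \<psi> where \<psi>: "continuous_on UNIV \<psi>" "\<And>x. \<bar>\<psi> x\<bar> \<le> 1" "v = signed_integral ?m \<psi>"
      by auto
    have "a i * \<psi> (x i) \<le> \<bar>a i\<bar>" for i
    proof -
      have "\<bar>a i * \<psi> (x i)\<bar> \<le> \<bar>a i\<bar> * 1"
        unfolding abs_mult using \<psi>(2) by (intro mult_left_mono) auto
      then show ?thesis by simp
    qed
    then show "v \<le> (\<Sum>i\<in>{1..N}. \<bar>a i\<bar>)" unfolding \<psi>(3) int[OF \<psi>(1)] by (intro sum_mono)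
  qed
  have "(\<Sum>i\<in>{1..N}. \<bar>a i\<bar>) = signed_integral ?m \<psi>"
    unfolding int[OF \<psi>(1)] by (intro sum.cong) (auto simp: \<psi>(3) abs_sgn)
  also have "\<dots> \<le> tv_norm ?m"
    unfolding tv_norm_def using \<psi> by (intro cSup_upper bdd) auto
  also have "\<dots> = inner Y0 (toL2 p)"
    by (simp only: \<eta>(3)[symmetric] int[OF \<eta>(1)] inner_Y0 \<eta>_eq)
  finally have ge: "(\<Sum>i\<in>{1..N}. \<bar>a i\<bar>) \<le> inner Y0 (toL2 p)" .
  have ball: "toL2 p \<in> dual_ball \<phi> UNIV"
    using \<eta>(2) by (simp add: dual_ball_def \<eta>_eq)
  with ge inner_Y0_le[OF _ ball] have "toL2 p \<in> dual_face UNIV" by auto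
  then show ?thesis by blast
qed

text \<open>Here \<open>D\<close> is the rescaled residual of a primal solution and \<open>V\<close> the noise divided by \<open>lam\<close>.
  The variational inequality makes \<open>D\<close> almost optimal in the limit dual problem, with a norm hardly
  exceeding the minimal one.\<close>

lemma dual_vector_near_min_norm:
  assumes S: "x ` {1..N} \<subseteq> S" and P: "P \<in> dual_face S"
    and min: "\<And>Q. Q \<in> dual_face S \<Longrightarrow> norm P \<le> norm Q" and "e > 0"
  obtains \<alpha> lam0 where "\<alpha> > 0" "lam0 > 0"
    "\<And>D V lam. D \<in> dual_ball \<phi> S \<Longrightarrow> 0 < lam \<Longrightarrow> lam < lam0 \<Longrightarrow> norm V < \<alpha> \<Longrightarrow>
      inner (Y0 + lam *\<^sub>R (V - D)) (P - D) \<le> 0 \<Longrightarrow> norm (D - P) < e"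
proof -
  define v where "v = (\<Sum>i\<in>{1..N}. \<bar>a i\<bar>)"
  define Q where "Q = norm P"
  \<comment> \<open>Feasible vectors within 1/(n+1) of the optimal value; the intersection of these
    nested closed convex sets is contained in the dual face.\<close>
  define K where "K n = {D \<in> dual_ball \<phi> S. v - 1 / (real n + 1) \<le> inner Y0 D}" for n
  have P_ball: "P \<in> dual_ball \<phi> S" using P by (simp add: dual_face_def)
  have P_val: "inner Y0 P = v" using inner_Y0_le(2)[OF S P_ball] P by (simp add: v_def)
  have K_eq: "K n = dual_ball \<phi> S \<inter> {D. v - 1 / (real n + 1) \<le> inner Y0 D}" for n
    by (auto simp: K_def)
  have half: "closed {D. c \<le> inner Y0 D}" "convex {D. c \<le> inner Y0 D}" for c
    by (intro closed_Collect_le continuous_intros, rule convex_halfspace_ge)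
  have K1: "convex (K n)" "closed (K n)" for n
    unfolding K_eq by (intro convex_Int closed_Int convex_dual_ball closed_dual_ball half)+
  have K2: "K n \<subseteq> K m" if "m \<le> n" for m n
  proof -
    have "1 / (real n + 1) \<le> 1 / (real m + 1)" using that by (auto simp: divide_simps)
    then show ?thesis by (auto simp: K_def)
  qed
  have K3: "P \<in> K n" for n using P_ball P_val by (simp add: K_def)
  have K4: "norm P \<le> norm D" if D: "\<And>n. D \<in> K n" for D
  proof (rule min)
    have ball: "D \<in> dual_ball \<phi> S" using D[of 0] by (simp add: K_def)
    have "v \<le> inner Y0 D"
    proof (rule field_le_epsilon)
      fix e :: real assume "e > 0"
      then obtain n where "inverse (real (Suc n)) < e" using reals_Archimedean by blast
      moreover have "v - 1 / (real n + 1) \<le> inner Y0 D" using D[of n] by (simp add: K_def)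
      ultimately show "v \<le> inner Y0 D + e" by (simp add: inverse_eq_divide algebra_simps)
    qed
    then show "D \<in> dual_face S" using inner_Y0_le[OF S ball] by (simp add: v_def)
  qed
  obtain d n where d: "d > 0" and near: "\<And>D. D \<in> K n \<Longrightarrow> norm D \<le> norm P + d \<Longrightarrow> norm (D - P) < e"
    using nested_near_min_norm[of K P e, OF K1 K2 K3 K4 \<open>e > 0\<close>] by blast
  \<comment> \<open>The quadratic inequality below gives \<open>R \<le> Q + 2 * \<alpha>\<close>, so
    half of \<open>d\<close> suffices. \<open>C\<close> bounds
    \<open>norm (D - V) * norm (P - D)\<close>, and \<open>lam0\<close> brings
    \<open>lam * C\<close> under the slack of \<open>K n\<close>.\<close>
  define \<alpha> where "\<alpha> = d / 2"
  define C where "C = (Q + 3 * \<alpha>) * (2 * Q + 2 * \<alpha>)"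
  define lam0 where "lam0 = 1 / (real n + 1) / (C + 1)"
  have Q0: "0 \<le> Q" by (simp add: Q_def)
  have \<alpha>: "\<alpha> > 0" using d by (simp add: \<alpha>_def)
  have C: "0 \<le> C" using Q0 \<alpha> by (simp add: C_def)
  have lam0: "lam0 > 0" using C by (simp add: lam0_def)
  have "norm (D - P) < e"
    if D: "D \<in> dual_ball \<phi> S" and lam: "0 < lam" "lam < lam0" and V: "norm V < \<alpha>"
      and var: "inner (Y0 + lam *\<^sub>R (V - D)) (P - D) \<le> 0" for D V lam
  proof -
    define R where "R = norm D"
    have R0: "0 \<le> R" by (simp add: R_def)
    have split: "inner Y0 (P - D) \<le> lam * inner (D - V) (P - D)"
      using var by (simp add: inner_add_left inner_diff_left algebra_simps)
    \<comment> \<open>Feasibility of \<open>D\<close> keeps it from beating \<open>P\<close> on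
      \<open>Y0\<close>. The term in \<open>Y0\<close> can therefore be dropped and
      \<open>lam\<close> divided out, leaving a bound on \<open>D\<close> in terms of
      \<open>P\<close> and \<open>V\<close> alone.\<close>
    have Y_nonneg: "0 \<le> inner Y0 (P - D)"
      using inner_Y0_le(1)[OF S D] P_val by (simp add: inner_diff_right v_def)
    with split lam have "0 \<le> inner (D - V) (P - D)"
      by (smt (verit) mult_pos_neg)
    then have "R\<^sup>2 \<le> inner D P - inner V (P - D)"
      by (simp add: R_def power2_norm_eq_inner inner_diff_left inner_diff_right)
    also have "\<dots> \<le> R * Q + \<alpha> * (Q + R)"
    proof -
      have "inner D P \<le> R * Q" unfolding R_def Q_def by (rule norm_cauchy_schwarz)
      moreover have "\<bar>inner V (P - D)\<bar> \<le> norm V * norm (P - D)" by (rule Cauchy_Schwarz_ineq2)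
      moreover have "norm V * norm (P - D) \<le> \<alpha> * (Q + R)"
        unfolding Q_def R_def using V \<alpha> by (intro mult_mono norm_triangle_ineq4) auto
      ultimately show ?thesis by linarith
    qed
    finally have R_sq: "R\<^sup>2 \<le> R * Q + \<alpha> * (Q + R)" .
    have R: "R \<le> Q + 2 * \<alpha>"
    proof (rule ccontr)
      assume "\<not> R \<le> Q + 2 * \<alpha>"
      then have "R * (Q + 2 * \<alpha>) < R * R" using Q0 \<alpha> by (intro mult_strict_left_mono) auto
      moreover have "\<alpha> * (Q + R) \<le> \<alpha> * (2 * R)"
        using \<open>\<not> R \<le> Q + 2 * \<alpha>\<close> \<alpha> by (intro mult_left_mono) auto
      ultimately show False using R_sq by (simp add: power2_eq_square algebra_simps)
    qed
    have "inner (D - V) (P - D) \<le> norm (D - V) * norm (P - D)" by (rule norm_cauchy_schwarz)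
    also have "\<dots> \<le> (Q + 3 * \<alpha>) * (2 * Q + 2 * \<alpha>)"
    proof (rule mult_mono)
      show "norm (D - V) \<le> Q + 3 * \<alpha>"
        using norm_triangle_ineq4[of D V] R V by (simp add: R_def)
      show "norm (P - D) \<le> 2 * Q + 2 * \<alpha>"
        using norm_triangle_ineq4[of P D] R by (simp add: R_def Q_def)
    qed (use Q0 \<alpha> in auto)
    finally have "lam * inner (D - V) (P - D) \<le> lam * C"
      using lam by (simp add: C_def)
    also have "\<dots> \<le> lam0 * (C + 1)" using lam C by (intro mult_mono) auto
    also have "\<dots> = 1 / (real n + 1)" using C by (simp add: lam0_def)
    finally have "inner Y0 (P - D) \<le> 1 / (real n + 1)" using split by simp
    then have "D \<in> K n" using D P_val by (simp add: K_def inner_diff_right)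
    moreover have "norm D \<le> norm P + d" using R by (simp add: R_def Q_def \<alpha>_def)
    ultimately show ?thesis by (rule near)
  qed
  with \<alpha> lam0 show ?thesis by (rule that)
qed

text \<open>The optimality conditions make the rescaled residual \<open>D\<close> feasible and equal
  to the sign of the mass at every atom. For small noise and small \<open>lam\<close> its values on
  the grid are within \<delta> of those of \<open>P\<close>, and a value of \<open>P\<close> that
  close to a sign must be that sign.\<close>

lemma primal_solution_saturates:
  assumes S: "x ` {1..N} \<subseteq> grid n" and P: "P \<in> dual_face (grid n)"
    and min: "\<And>Q. Q \<in> dual_face (grid n) \<Longrightarrow> norm P \<le> norm Q"
  obtains \<alpha> lam0 where "\<alpha> > 0" "lam0 > 0"
    "\<And>w lam m. w \<in> L2 \<Longrightarrow> 0 < lam \<Longrightarrow> lam < lam0 \<Longrightarrow> L2_norm w / lam < \<alpha> \<Longrightarrow>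
      primal_solution_grid \<phi> n lam (\<lambda>t. y0 t + w t) m \<Longrightarrow>
      measure_support m \<subseteq> {t \<in> grid n. m {t} \<noteq> 0} \<and>
      (\<forall>t. m {t} \<noteq> 0 \<longrightarrow> t \<in> grid n \<and> inner (kernel_at \<phi> t) P = sgn (m {t}))"
proof -
  let ?G = "grid n"
  \<comment> \<open>The smallest gap to 1 among the unsaturated grid points. The inserted 1 covers
    the case without such points and gives \<open>\<delta> \<le> 1\<close>, so opposite signs are
    more than \<delta> apart.\<close>
  define \<delta> where "\<delta> = Min (insert 1 ((\<lambda>t. 1 - \<bar>inner (kernel_at \<phi> t) P\<bar>) `
    {t\<in>?G. \<bar>inner (kernel_at \<phi> t) P\<bar> < 1}))"
  have fin: "finite (insert 1 ((\<lambda>t. 1 - \<bar>inner (kernel_at \<phi> t) P\<bar>) `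
    {t\<in>?G. \<bar>inner (kernel_at \<phi> t) P\<bar> < 1}))" using finite_grid by simp
  have \<delta>: "\<delta> > 0" "\<delta> \<le> 1"
    "\<And>t. t \<in> ?G \<Longrightarrow> \<bar>inner (kernel_at \<phi> t) P\<bar> < 1 \<Longrightarrow> \<delta> \<le> 1 - \<bar>inner (kernel_at \<phi> t) P\<bar>"
    unfolding \<delta>_def using fin by (auto simp: Min_gr_iff intro: Min_le)
  obtain B where B: "B > 0" "\<And>t. norm (kernel_at \<phi> t) \<le> B"
    using norm_kernel_at_bound[OF phi_cont(1)] by blast
  have "\<delta> / B > 0" using \<delta> B by simp
  then obtain \<alpha> lam0 where \<alpha>: "\<alpha> > 0" "lam0 > 0" and near:
    "\<And>D V lam. D \<in> dual_ball \<phi> ?G \<Longrightarrow> 0 < lam \<Longrightarrow> lam < lam0 \<Longrightarrow> norm V < \<alpha> \<Longrightarrow>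
      inner (Y0 + lam *\<^sub>R (V - D)) (P - D) \<le> 0 \<Longrightarrow> norm (D - P) < \<delta> / B"
    using dual_vector_near_min_norm[OF S P min] by metis
  have "measure_support m \<subseteq> {t \<in> ?G. m {t} \<noteq> 0} \<and>
      (\<forall>t. m {t} \<noteq> 0 \<longrightarrow> t \<in> ?G \<and> inner (kernel_at \<phi> t) P = sgn (m {t}))"
    if w: "w \<in> L2" and lam: "0 < lam" "lam < lam0" and small: "L2_norm w / lam < \<alpha>"
      and m: "primal_solution_grid \<phi> n lam (\<lambda>t. y0 t + w t) m" for w lam m
  proof -
    define M where "M = (\<Sum>t\<in>?G. m {t} *\<^sub>R kernel_at \<phi> t)"
    define y where "y = toL2 (\<lambda>t. y0 t + w t)"
    define V where "V = toL2 w /\<^sub>R lam"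
    define D where "D = (y - M) /\<^sub>R lam"
    have y_L2: "(\<lambda>t. y0 t + w t) \<in> L2" using y0_L2 w by (rule L2_add)
    have y: "y = Y0 + lam *\<^sub>R V"
      using lam w by (simp add: y_def V_def toL2_add y0_L2 toL2_y0)
    have lamD: "lam *\<^sub>R D = y - M" using lam by (simp add: D_def)
    note sol = primal_solution_gridD[OF phi_cont(1) y_L2 lam(1) m]
    have g: "inner (kernel_at \<phi> t) (y - M) = lam * inner (kernel_at \<phi> t) D" for t
      unfolding lamD[symmetric] by simp
    have opt: "\<bar>inner (kernel_at \<phi> t) D\<bar> \<le> 1"
      "m {t} \<noteq> 0 \<Longrightarrow> inner (kernel_at \<phi> t) D = sgn (m {t})" if "t \<in> ?G" for t
      using lasso_optimality[OF finite_grid that lam(1) sol(3)] lam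
      unfolding M_def[symmetric] y_def[symmetric] g by (auto simp: abs_mult)
    have D: "D \<in> dual_ball \<phi> ?G" using opt(1) by (simp add: dual_ball_def)
    \<comment> \<open>On each atom \<open>D\<close> reaches the modulus of the mass while
      \<open>P\<close> is at most that. As \<open>M\<close> equals
      \<open>Y0 + lam *\<^sub>R (V - D)\<close>, this is the required variational
      inequality.\<close>
    have "inner M (P - D) \<le> 0"
    proof -
      have "m {t} * inner (kernel_at \<phi> t) (P - D) \<le> 0" if "t \<in> ?G" for t
      proof (cases "m {t} = 0")
        case False
        have "\<bar>m {t} * inner (kernel_at \<phi> t) P\<bar> \<le> \<bar>m {t}\<bar> * 1"
          unfolding abs_mult using P that
          by (intro mult_left_mono) (auto simp: dual_face_def dual_ball_def)
        moreover have "m {t} * inner (kernel_at \<phi> t) D = \<bar>m {t}\<bar>"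
          using opt(2)[OF that False] by (simp add: abs_sgn)
        ultimately show ?thesis by (simp add: inner_diff_right right_diff_distrib)
      qed simp
      then have "(\<Sum>t\<in>?G. m {t} * inner (kernel_at \<phi> t) (P - D)) \<le> 0" by (rule sum_nonpos)
      then show ?thesis by (simp add: M_def inner_sum_left)
    qed
    moreover have "Y0 + lam *\<^sub>R (V - D) = M"
      using lamD by (simp add: y scaleR_diff_right algebra_simps)
    moreover have "norm V < \<alpha>"
      using small lam w by (simp add: V_def norm_toL2 divide_inverse mult.commute)
    ultimately have dist: "norm (D - P) < \<delta> / B" using near[OF D lam] by simp
    have "inner (kernel_at \<phi> t) P = sgn (m {t})" if t: "t \<in> ?G" "m {t} \<noteq> 0" for t
    proof -
      have "\<bar>inner (kernel_at \<phi> t) (D - P)\<bar> \<le> norm (kernel_at \<phi> t) * norm (D - P)"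
        by (rule Cauchy_Schwarz_ineq2)
      also have "\<dots> \<le> B * norm (D - P)" using B by (intro mult_right_mono) auto
      also have "\<dots> < B * (\<delta> / B)" using B dist by (intro mult_strict_left_mono) auto
      finally have *: "\<bar>sgn (m {t}) - inner (kernel_at \<phi> t) P\<bar> < \<delta>"
        using B opt(2)[OF t] by (simp add: inner_diff_right)
      have "\<bar>inner (kernel_at \<phi> t) P\<bar> \<le> 1"
        using P t by (auto simp: dual_face_def dual_ball_def)
      moreover have "\<not> \<bar>inner (kernel_at \<phi> t) P\<bar> < 1"
        using \<delta>(3)[OF t(1)] * t(2) by (auto simp: sgn_if split: if_splits)
      ultimately show ?thesis using * \<delta>(2) t(2) by (auto simp: sgn_if split: if_splits)
    qed
    moreover have "t \<in> ?G" if "m {t} \<noteq> 0" for t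
    proof (rule ccontr)
      assume "t \<notin> ?G"
      have "m {t} = atomic_measure ?G (\<lambda>t. m {t}) (\<lambda>t. t) {t}"
        using radon_measure_eq_atomic[OF sol(1) finite_grid sol(2)] by (rule fun_cong)
      also have "\<dots> = 0"
        unfolding atomic_measure_def using \<open>t \<notin> ?G\<close> by (auto simp: indicator_def intro!: sum.neutral)
      finally show False using that by simp
    qed
    ultimately show ?thesis
      using measure_support_subset_atoms[OF sol(1) finite_grid sol(2)] by blast
  qed
  with \<alpha> show ?thesis by (rule that)
qed

end

section \<open>Convergence of the certificates\<close>

context spikes
begin

text \<open>Strict inequalities, chosen to survive a small perturbation of \<open>P\<close>. The
  lower bound 1/2 excludes saturation with the wrong sign near a spike.\<close>

definition concave_spikes :: "real \<Rightarrow> l2 \<Rightarrow> bool"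
  where "concave_spikes r P \<longleftrightarrow>
    (\<forall>t. (\<forall>i\<in>{1..N}. \<forall>u. \<bar>u\<bar> < r \<longrightarrow> t \<noteq> x i + torus_of u) \<longrightarrow> \<bar>inner (kernel_at \<phi> t) P\<bar> < 1) \<and>
    (\<forall>i\<in>{1..N}. \<forall>u. \<bar>u\<bar> < r \<longrightarrow>
      1/2 < sgn (a i) * inner (kernel_at \<phi> (x i + torus_of u)) P \<and>
      sgn (a i) * inner (kernel_at (torus_deriv (torus_deriv \<phi>)) (x i + torus_of u)) P < 0)"

lemma min_norm_converges:
  assumes P0: "P0 \<in> dual_face UNIV" "\<And>Q. Q \<in> dual_face UNIV \<Longrightarrow> norm P0 \<le> norm Q"
    and P: "\<And>n. n \<ge> n0 \<Longrightarrow> P n \<in> dual_face (grid n)"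
      "\<And>n Q. n \<ge> n0 \<Longrightarrow> Q \<in> dual_face (grid n) \<Longrightarrow> norm (P n) \<le> norm Q"
    and "e > 0"
  shows "\<forall>\<^sub>F n in sequentially. norm (P n - P0) < e"
proof -
  define K where "K n = dual_face (grid (n0 + n))" for n
  have P0_grid: "P0 \<in> dual_face (grid n)" for n
    using P0(1) dual_face_antimono[of "grid n" UNIV] by auto
  have K1: "convex (K n)" "closed (K n)" "P0 \<in> K n" for n
    unfolding K_def by (intro convex_dual_face closed_dual_face P0_grid)+
  have K2: "K n \<subseteq> K m" if "m \<le> n" for m n
    unfolding K_def using that by (intro dual_face_antimono grid_mono) simp
  \<comment> \<open>A vector in all grid faces satisfies the constraint on a dense set, hence
    everywhere by continuity, and so competes with \<open>P0\<close>.\<close>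
  have K3: "norm P0 \<le> norm Q" if Q: "\<And>n. Q \<in> K n" for Q
  proof (rule P0(2))
    have cont: "continuous_on UNIV (\<lambda>t. \<bar>inner (kernel_at \<phi> t) Q\<bar>)"
      using continuous_on_kernel_at[OF phi_cont(1), of 0]
      by (auto simp: continuous_on_torus_iff intro!: continuous_intros)
    have "\<bar>inner (kernel_at \<phi> t) Q\<bar> \<le> 1" if "n \<ge> n0" "t \<in> grid n" for n t
      using Q[of "n - n0"] that by (auto simp: K_def dual_face_def dual_ball_def)
    then have "\<bar>inner (kernel_at \<phi> t) Q\<bar> \<le> 1" for t
      using grid_dense_bound[OF cont, of n0 1] by blast
    then show "Q \<in> dual_face UNIV"
      using Q[of 0] by (auto simp: K_def dual_face_def dual_ball_def)
  qed
  obtain d M where d: "d > 0"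
    "\<And>Q. Q \<in> K M \<Longrightarrow> norm Q \<le> norm P0 + d \<Longrightarrow> norm (Q - P0) < e"
    using nested_near_min_norm[of K P0 e, OF K1(1,2) K2 K1(3) K3 \<open>e > 0\<close>] by blast
  have "norm (P n - P0) < e" if "n \<ge> n0 + M" for n
  proof (rule d(2))
    have n: "n \<ge> n0" using that by simp
    \<comment> \<open>\<open>P0\<close> is admissible on every grid, so the grid minimum cannot have
      larger norm.\<close>
    show "norm (P n) \<le> norm P0 + d" using P(2)[OF n P0_grid] d(1) by simp
    show "P n \<in> K M"
      using P(1)[OF n] dual_face_antimono[OF grid_mono[OF that]] by (auto simp: K_def)
  qed
  then show ?thesis unfolding eventually_sequentially by blast
qed

text \<open>The same inequalities are first proved for the limit vector \<open>P0\<close> with room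
  to spare. The kernels and their second derivatives have bounded norms, so norm convergence
  preserves the inequalities at all points at once.\<close>

lemma concave_spikes_eventually:
  assumes face: "dual_face UNIV \<noteq> {}"
    and off: "\<And>s. s \<notin> x ` {1..N} \<Longrightarrow> \<bar>certificate \<phi> UNIV y0 s\<bar> < 1"
    and curv: "\<And>i. i \<in> {1..N} \<Longrightarrow>
      torus_deriv (torus_deriv (certificate \<phi> UNIV y0)) (x i) \<noteq> 0"
    and P: "\<And>n. n \<ge> n0 \<Longrightarrow> P n \<in> dual_face (grid n)"
      "\<And>n Q. n \<ge> n0 \<Longrightarrow> Q \<in> dual_face (grid n) \<Longrightarrow> norm (P n) \<le> norm Q"
  obtains r where "r > 0" "\<forall>\<^sub>F n in sequentially. concave_spikes r (P n)"
proof -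
  define \<phi>2 where "\<phi>2 = torus_deriv (torus_deriv \<phi>)"
  obtain P0 where P0: "P0 \<in> dual_face UNIV" "\<And>Q. Q \<in> dual_face UNIV \<Longrightarrow> norm P0 \<le> norm Q"
    and cert: "\<And>t. certificate \<phi> UNIV y0 t = inner (kernel_at \<phi> t) P0"
    using certificate_min_norm[OF _ face] by auto
  have cert_eq: "certificate \<phi> UNIV y0 = (\<lambda>t. inner (kernel_at \<phi> t) P0)"
    using cert by (rule ext)
  have cert2: "torus_deriv (torus_deriv (certificate \<phi> UNIV y0)) = (\<lambda>t. inner (kernel_at \<phi>2 t) P0)"
    unfolding cert_eq \<phi>2_def
    by (simp add: torus_deriv_inner_kernel phi_diff phi_cont)
  have P0_le: "\<bar>inner (kernel_at \<phi> t) P0\<bar> \<le> 1" for t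
    using P0(1) by (simp add: dual_face_def dual_ball_def)
  define g where "g i u = sgn (a i) * inner (kernel_at \<phi> (x i + torus_of u)) P0" for i u
  define h where "h i u = sgn (a i) * inner (kernel_at \<phi>2 (x i + torus_of u)) P0" for i u
  have g0: "g i 0 = 1" if "i \<in> {1..N}" for i
    using P0(1) that a_nonzero[OF that]
    by (auto simp: g_def torus_of_zero dual_face_def sgn_mult_self_eq)
  \<comment> \<open>The certificate times the sign has its maximum 1 at the spike, so its second
    derivative is at most 0 there; nondegeneracy makes it negative.\<close>
  have h0: "h i 0 < 0" if i: "i \<in> {1..N}" for i
  proof -
    let ?g' = "\<lambda>u. sgn (a i) * inner (kernel_at (torus_deriv \<phi>) (x i + torus_of u)) P0"
    have "(g i has_real_derivative ?g' u) (at u)" for u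
      unfolding g_def[abs_def]
      by (intro DERIV_cmult inner_kernel_has_derivative phi_diff phi_cont)
    moreover have "(?g' has_real_derivative h i 0) (at 0)"
      unfolding h_def \<phi>2_def
      by (intro DERIV_cmult inner_kernel_has_derivative phi_diff phi_cont)
    moreover have "g i u \<le> g i 0" for u
    proof -
      have "\<bar>g i u\<bar> \<le> 1" unfolding g_def abs_mult using P0_le sgn_abs_a[OF i] by simp
      then show ?thesis using g0[OF i] by simp
    qed
    ultimately have "h i 0 \<le> 0" by (rule local_max_second_derivative)
    moreover have "h i 0 \<noteq> 0"
      using curv[OF i] a_nonzero[OF i] by (simp add: h_def cert2 torus_of_zero sgn_zero_iff)
    ultimately show ?thesis by simp
  qed
  \<comment> \<open>The thresholds 3/4 and \<open>h i 0 / 2\<close> leave margins 1/4 and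
    \<open>- h i 0 / 2\<close> for replacing \<open>P0\<close> by \<open>P n\<close>.\<close>
  have near: "\<forall>\<^sub>F u in nhds 0. 3/4 < g i u \<and> h i u < h i 0 / 2" if i: "i \<in> {1..N}" for i
  proof -
    have "continuous_on UNIV (g i)" "continuous_on UNIV (h i)"
      unfolding g_def[abs_def] h_def[abs_def] \<phi>2_def
      by (intro continuous_intros continuous_on_kernel_at phi_cont)+
    then have "isCont (g i) 0" "isCont (h i) 0"
      by (simp_all add: continuous_on_eq_continuous_at)
    then have "(g i \<longlongrightarrow> g i 0) (nhds 0)" "(h i \<longlongrightarrow> h i 0) (nhds 0)"
      by (simp_all add: isCont_def tendsto_at_iff_tendsto_nhds)
    then show ?thesis
      using g0[OF i] h0[OF i] by (intro eventually_conj order_tendstoD) auto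
  qed
  have "\<forall>\<^sub>F u in nhds 0. \<forall>i\<in>{1..N}. 3/4 < g i u \<and> h i u < h i 0 / 2"
    using near by (intro eventually_ball_finite) auto
  then obtain r where r: "r > 0"
    "\<And>u i. \<bar>u\<bar> < r \<Longrightarrow> i \<in> {1..N} \<Longrightarrow> 3/4 < g i u \<and> h i u < h i 0 / 2"
    unfolding eventually_nhds_metric by (auto simp: dist_real_def)
  define C where "C = - (\<Union>i\<in>{1..N}. {x i + torus_of u | u. \<bar>u\<bar> < r})"
  have "closed C"
    unfolding C_def by (intro closed_Compl open_UN ballI open_torus_nbhd)
  then have "compact C" using compact_Int_closed[OF compact_torus] by simp
  \<comment> \<open>On the compact set \<open>C\<close>, which contains no spike, the modulus
    attains its maximum, so pointwise strictness becomes a uniform gap.\<close>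
  have "\<exists>c<1. \<forall>t\<in>C. \<bar>inner (kernel_at \<phi> t) P0\<bar> \<le> c"
  proof (cases "C = {}")
    case False
    have "continuous_on UNIV (\<lambda>t. \<bar>inner (kernel_at \<phi> t) P0\<bar>)"
      using continuous_on_kernel_at[OF phi_cont(1), of 0]
      by (auto simp: continuous_on_torus_iff intro!: continuous_intros)
    then have "continuous_on C (\<lambda>t. \<bar>inner (kernel_at \<phi> t) P0\<bar>)"
      by (rule continuous_on_subset) simp
    from continuous_attains_sup[OF \<open>compact C\<close> False this] obtain t where t: "t \<in> C"
      "\<forall>s\<in>C. \<bar>inner (kernel_at \<phi> s) P0\<bar> \<le> \<bar>inner (kernel_at \<phi> t) P0\<bar>" by blast
    have "t \<noteq> x i" if "i \<in> {1..N}" for i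
    proof
      assume "t = x i"
      then have "t = x i + torus_of 0" by (simp add: torus_of_zero)
      then have "t \<in> {x i + torus_of u | u. \<bar>u\<bar> < r}" using r(1) by fastforce
      then show False using t(1) that unfolding C_def by blast
    qed
    then have "t \<notin> x ` {1..N}" by blast
    then have "\<bar>inner (kernel_at \<phi> t) P0\<bar> < 1" unfolding cert[symmetric] by (rule off)
    with t(2) show ?thesis by blast
  qed (auto intro!: exI[of _ 0])
  then obtain c where c: "c < 1" "\<And>t. t \<in> C \<Longrightarrow> \<bar>inner (kernel_at \<phi> t) P0\<bar> \<le> c" by blast
  obtain B where B: "B > 0" "\<And>t. norm (kernel_at \<phi> t) \<le> B"
    using norm_kernel_at_bound[OF phi_cont(1)] by blast
  obtain B2 where B2: "B2 > 0" "\<And>t. norm (kernel_at \<phi>2 t) \<le> B2"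
    unfolding \<phi>2_def using norm_kernel_at_bound[OF phi_cont(3)] by blast
  have conv: "\<forall>\<^sub>F n in sequentially. b * norm (P n - P0) < e" if "b > 0" "e > 0" for b e
  proof -
    have "\<forall>\<^sub>F n in sequentially. norm (P n - P0) < e / b"
      using that by (intro min_norm_converges[OF P0 P]) auto
    then show ?thesis
      by eventually_elim (use that in \<open>simp add: pos_less_divide_eq mult.commute\<close>)
  qed
  have "\<forall>\<^sub>F n in sequentially. \<forall>i\<in>{1..N}. B2 * norm (P n - P0) < - h i 0 / 2"
    using h0 B2(1) by (intro eventually_ball_finite ballI conv) auto
  moreover have "\<forall>\<^sub>F n in sequentially. B * norm (P n - P0) < 1 - c"
    using c(1) B(1) by (intro conv) auto
  moreover have "\<forall>\<^sub>F n in sequentially. B * norm (P n - P0) < 1/4"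
    using B(1) by (intro conv) auto
  ultimately have "\<forall>\<^sub>F n in sequentially. concave_spikes r (P n)"
  proof eventually_elim
    fix n
    assume close: "\<forall>i\<in>{1..N}. B2 * norm (P n - P0) < - h i 0 / 2"
      "B * norm (P n - P0) < 1 - c" "B * norm (P n - P0) < 1/4"
    have diff: "\<bar>inner k (P n) - inner k P0\<bar> \<le> b * norm (P n - P0)" if "norm k \<le> b" for k b
    proof -
      have "\<bar>inner k (P n - P0)\<bar> \<le> norm k * norm (P n - P0)" by (rule Cauchy_Schwarz_ineq2)
      also have "\<dots> \<le> b * norm (P n - P0)" using that by (intro mult_right_mono) auto
      finally show ?thesis by (simp add: inner_diff_right)
    qed
    show "concave_spikes r (P n)"
      unfolding concave_spikes_def
    proof (intro conjI allI ballI impI)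
      fix t assume "\<forall>i\<in>{1..N}. \<forall>u. \<bar>u\<bar> < r \<longrightarrow> t \<noteq> x i + torus_of u"
      then have "t \<in> C" by (auto simp: C_def)
      then show "\<bar>inner (kernel_at \<phi> t) (P n)\<bar> < 1"
        using c(2) close(2) diff[OF B(2), of t] by fastforce
    next
      fix i u assume i: "i \<in> {1..N}" and u: "\<bar>u\<bar> < r"
      let ?t = "x i + torus_of u"
      have sgn_diff: "\<bar>sgn (a i) * v - sgn (a i) * w\<bar> = \<bar>v - w\<bar>" for v w
        using sgn_abs_a[OF i] by (simp add: right_diff_distrib[symmetric] abs_mult)
      show "1/2 < sgn (a i) * inner (kernel_at \<phi> ?t) (P n)"
        using r(2)[OF u i] close(3) diff[OF B(2), of ?t]
          sgn_diff[of "inner (kernel_at \<phi> ?t) (P n)" "inner (kernel_at \<phi> ?t) P0"]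
        unfolding g_def by linarith
      have "B2 * norm (P n - P0) < - h i 0 / 2" using close(1) i by blast
      then show "sgn (a i) * inner (kernel_at (torus_deriv (torus_deriv \<phi>)) ?t) (P n) < 0"
        using r(2)[OF u i] diff[OF B2(2), of ?t]
          sgn_diff[of "inner (kernel_at \<phi>2 ?t) (P n)" "inner (kernel_at \<phi>2 ?t) P0"]
        unfolding h_def \<phi>2_def by linarith
    qed
  qed
  with r(1) show ?thesis by (rule that)
qed

section \<open>Saturated grid points near a spike\<close>

lemma concave_spikes_interior:
  assumes P: "concave_spikes r P" and i: "i \<in> {1..N}"
    and uvw: "- r < u" "u < v" "v < w" "w < r"
  defines "g \<equiv> \<lambda>u. sgn (a i) * inner (kernel_at \<phi> (x i + torus_of u)) P"
  shows "g u < g v \<or> g w < g v"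
proof (rule neg_second_derivative_interior[OF _ _ _ uvw(2,3)])
  let ?g' = "\<lambda>u. sgn (a i) * inner (kernel_at (torus_deriv \<phi>) (x i + torus_of u)) P"
  let ?g'' = "\<lambda>u. sgn (a i) * inner (kernel_at (torus_deriv (torus_deriv \<phi>)) (x i + torus_of u)) P"
  show "(g has_real_derivative ?g' s) (at s)" for s
    unfolding g_def by (intro DERIV_cmult inner_kernel_has_derivative phi_diff phi_cont)
  show "(?g' has_real_derivative ?g'' s) (at s)" for s
    by (intro DERIV_cmult inner_kernel_has_derivative phi_diff phi_cont)
  show "?g'' s < 0" if "u < s" "s < w" for s
    using P i uvw that by (auto simp: concave_spikes_def abs_less_iff)
qed

text \<open>By strict concavity, a certificate that is 1 at a spike and at most 1 at its two
  neighbours on the grid is 1 at no more than one other grid point nearby, which is one of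
  these neighbours.\<close>

lemma saturated_grid_points:
  assumes S: "x ` {1..N} \<subseteq> grid n" and P: "P \<in> dual_face (grid n)"
    and spikes: "concave_spikes r P" and n: "1 / 2 ^ n < r"
  obtains \<epsilon> :: "nat \<Rightarrow> real" where "\<And>i. i \<in> {1..N} \<Longrightarrow> \<epsilon> i \<in> {1, -1}"
    "\<And>t. t \<in> grid n \<Longrightarrow> \<bar>inner (kernel_at \<phi> t) P\<bar> = 1 \<Longrightarrow>
      \<exists>i\<in>{1..N}. inner (kernel_at \<phi> t) P = sgn (a i) \<and>
        (t = x i \<or> t = x i + torus_of (\<epsilon> i / 2 ^ n))"
proof -
  define g where "g i u = sgn (a i) * inner (kernel_at \<phi> (x i + torus_of u)) P" for i u
  define H :: real where "H = 1 / 2 ^ n"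
  have H: "H > 0" "H < r" using n by (simp_all add: H_def)
  have g_le: "g i (of_int k * H) \<le> 1" if i: "i \<in> {1..N}" for i k
  proof -
    have "x i + torus_of (of_int k / 2 ^ n) \<in> grid n" using S i by (intro grid_add) auto
    then have "\<bar>inner (kernel_at \<phi> (x i + torus_of (of_int k / 2 ^ n))) P\<bar> \<le> 1"
      using P by (auto simp: dual_face_def dual_ball_def)
    then have "\<bar>g i (of_int k * H)\<bar> \<le> 1"
      using sgn_abs_a[OF i] by (simp add: g_def H_def abs_mult)
    then show ?thesis by simp
  qed
  have g0: "g i 0 = 1" if "i \<in> {1..N}" for i
    using P that a_nonzero[OF that]
    by (auto simp: g_def torus_of_zero dual_face_def sgn_mult_self_eq)
  have interior: "g i u < g i v \<or> g i w < g i v"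
    if "i \<in> {1..N}" "- r < u" "u < v" "v < w" "w < r" for i u v w
    unfolding g_def using concave_spikes_interior[OF spikes that] .
  \<comment> \<open>The right neighbour if it is saturated, otherwise the left one. They cannot both
    be, since the value at the spike between them would have to exceed 1.\<close>
  define \<epsilon> where "\<epsilon> i = (if g i H = 1 then 1 else - 1 :: real)" for i
  have "\<exists>i\<in>{1..N}. inner (kernel_at \<phi> t) P = sgn (a i) \<and>
        (t = x i \<or> t = x i + torus_of (\<epsilon> i / 2 ^ n))"
    if t: "t \<in> grid n" "\<bar>inner (kernel_at \<phi> t) P\<bar> = 1" for t
  proof -
    obtain i u where i: "i \<in> {1..N}" and u: "\<bar>u\<bar> < r" "t = x i + torus_of u"
      using spikes t(2) unfolding concave_spikes_def by force
    have "\<bar>g i u\<bar> = 1" using t(2) sgn_abs_a[OF i] by (simp add: g_def u(2) abs_mult)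
    moreover have "1/2 < g i u"
      using spikes i u(1) unfolding concave_spikes_def g_def by blast
    ultimately have gu: "g i u = 1" by linarith
    then have val: "inner (kernel_at \<phi> t) P = sgn (a i)"
      using a_nonzero[OF i] by (auto simp: g_def u(2) sgn_if split: if_splits)
    obtain k :: int where k: "u = of_int k / 2 ^ n"
      using grid_diff[of "x i" n u] S i t(1) u(2) by blast
    then have uk: "u = of_int k * H" by (simp add: H_def)
    consider "k = 0" | "k = 1" | "k = - 1" | "k \<ge> 2" | "k \<le> - 2" by linarith
    then have "t = x i \<or> t = x i + torus_of (\<epsilon> i / 2 ^ n)"
    proof cases
      case 1
      then show ?thesis by (simp add: u(2) k torus_of_zero)
    next
      case 2
      then have "\<epsilon> i = 1" using gu by (simp add: \<epsilon>_def uk)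
      then show ?thesis using 2 by (simp add: u(2) k)
    next
      case 3
      then have "g i (- H) = 1" using gu by (simp add: uk)
      then have "g i H \<noteq> 1"
        using interior[OF i, of "- H" 0 H] H g0[OF i] by auto
      then have "\<epsilon> i = - 1" by (simp add: \<epsilon>_def)
      then show ?thesis using 3 by (simp add: u(2) k)
    next
      case 4
      \<comment> \<open>Beyond the neighbour, \<open>H\<close> lies strictly between 0 and
        \<open>u\<close>. The value 1 at both ends would force a value above 1 at the grid point
        \<open>H\<close>, against feasibility.\<close>
      then have "H * 2 \<le> H * of_int k" using H by (intro mult_left_mono) auto
      then have "H < u" using H by (simp add: uk mult.commute)
      then have "1 < g i H"
        using interior[OF i, of 0 H u] H u(1) g0[OF i] gu by auto
      then show ?thesis using g_le[OF i, of 1] by simp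
    next
      case 5
      then have "H * of_int k \<le> H * (- 2)" using H by (intro mult_left_mono) auto
      then have "u < - H" using H by (simp add: uk mult.commute)
      then have "1 < g i (- H)"
        using interior[OF i, of u "- H" 0] H u(1) g0[OF i] gu by auto
      then show ?thesis using g_le[OF i, of "- 1"] by simp
    qed
    with i val show ?thesis by blast
  qed
  moreover have "\<epsilon> i \<in> {1, -1}" for i by (simp add: \<epsilon>_def)
  ultimately show ?thesis using that by blast
qed

end

theorem corollary4:
  fixes \<phi> :: "torus \<Rightarrow> real"
    and N :: nat
    and a :: "nat \<Rightarrow> real"
    and x :: "nat \<Rightarrow> torus"
  defines "y\<^sub>0 \<equiv> conv_op \<phi> (discrete_measure N a x)"
  defines "\<eta> \<equiv> \<lambda>n. certificate \<phi> (grid n) y\<^sub>0"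
  defines "admissible \<equiv> \<lambda>n (\<epsilon> :: nat \<Rightarrow> real).
    (\<forall>i\<in>{1..N}. \<epsilon> i \<in> {1, -1}) \<and>
    signed_support N a x \<subseteq> extended_support_grid \<phi> n y\<^sub>0 \<and>
    extended_support_grid \<phi> n y\<^sub>0 \<subseteq>
      signed_support N a x \<union> {(x i + torus_of (\<epsilon> i / 2 ^ n), \<eta> n (x i)) | i. i \<in> {1..N}}"
  assumes phi_C2: "C2_torus \<phi>"
    and a_nonzero: "\<forall>i\<in>{1..N}. a i \<noteq> 0"
    and x_distinct: "inj_on x {1..N}"
    and x_dyadic: "dyadic N x"
    and ndsc: "nondegenerate_source_condition \<phi> N a x"
  shows "\<forall>\<^sub>F n in sequentially.
    (\<exists>\<epsilon>. admissible n \<epsilon>) \<and>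
    (\<forall>\<epsilon>. admissible n \<epsilon> \<longrightarrow>
      (\<exists>\<alpha>>0. \<exists>lam\<^sub>0>0. \<forall>w\<in>L2. \<forall>lam. 0 < lam \<longrightarrow> lam < lam\<^sub>0 \<longrightarrow> L2_norm w / lam < \<alpha> \<longrightarrow>
        (\<forall>m. primal_solution_grid \<phi> n lam (\<lambda>t. y\<^sub>0 t + w t) m \<longrightarrow>
          measure_support m \<subseteq> x ` {1..N} \<union> {x i + torus_of (\<epsilon> i / 2 ^ n) | i. i \<in> {1..N}} \<and>
          (\<forall>i\<in>{1..N}.
            (m {x i} \<noteq> 0 \<longrightarrow> sgn (m {x i}) = \<eta> n (x i)) \<and>
            (m {x i + torus_of (\<epsilon> i / 2 ^ n)} \<noteq> 0 \<longrightarrow>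
              sgn (m {x i + torus_of (\<epsilon> i / 2 ^ n)}) = \<eta> n (x i))))))"
proof -
  interpret spikes \<phi> N a x
    using phi_C2 a_nonzero x_distinct by unfold_locales auto
  have y: "y\<^sub>0 = y0" by (simp add: y\<^sub>0_def y0_def)
  obtain n0 where "\<forall>i\<in>{1..N}. x i \<in> grid n0" using x_dyadic by (auto simp: dyadic_def)
  then have S: "x ` {1..N} \<subseteq> grid n" if "n \<ge> n0" for n
    using grid_mono[OF that] by auto
  obtain \<eta>' where \<eta>': "\<eta>' \<in> conv_adj \<phi> ` L2" "\<eta>' \<in> tv_subdifferential (discrete_measure N a x)"
    and off: "\<And>s. s \<notin> x ` {1..N} \<Longrightarrow> \<bar>certificate \<phi> UNIV y0 s\<bar> < 1"
    and curv: "\<And>i. i \<in> {1..N} \<Longrightarrow>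
      torus_deriv (torus_deriv (certificate \<phi> UNIV y0)) (x i) \<noteq> 0"
    using ndsc unfolding nondegenerate_source_condition_def Let_def y0_def by blast
  have face: "dual_face UNIV \<noteq> {}" using \<eta>' by (rule source_condition_dual_face)
  have "\<exists>P. P \<in> dual_face (grid n) \<and> (\<forall>Q\<in>dual_face (grid n). norm P \<le> norm Q) \<and>
      (\<forall>t. \<eta> n t = inner (kernel_at \<phi> t) P)" if "n \<ge> n0" for n
  proof -
    have "dual_face (grid n) \<noteq> {}" using face dual_face_antimono[of "grid n" UNIV] by auto
    then show ?thesis
      using certificate_min_norm[OF S[OF that]] unfolding \<eta>_def y by metis
  qed
  then obtain P where P: "\<And>n. n \<ge> n0 \<Longrightarrow> P n \<in> dual_face (grid n)"
    "\<And>n Q. n \<ge> n0 \<Longrightarrow> Q \<in> dual_face (grid n) \<Longrightarrow> norm (P n) \<le> norm Q"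
    "\<And>n t. n \<ge> n0 \<Longrightarrow> \<eta> n t = inner (kernel_at \<phi> t) (P n)"
    by metis
  obtain r where r: "r > 0" and spikes: "\<forall>\<^sub>F n in sequentially. concave_spikes r (P n)"
    using concave_spikes_eventually[of n0 P, OF face off curv P(1,2)] by blast
  have "(\<lambda>n. (1/2 :: real) ^ n) \<longlonglongrightarrow> 0" by (rule LIMSEQ_realpow_zero) auto
  then have "\<forall>\<^sub>F n in sequentially. (1/2 :: real) ^ n < r"
    using r by (rule order_tendstoD)
  with spikes eventually_ge_at_top[of n0] show ?thesis
  proof eventually_elim
    fix n assume n: "n0 \<le> n" and spikes: "concave_spikes r (P n)" and "(1/2 :: real) ^ n < r"
    then have small: "1 / 2 ^ n < r" by (simp add: power_one_over)
    note Sn = S[OF n] and face_n = P(1)[OF n] and \<eta> = P(3)[OF n]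
    have \<eta>_x: "\<eta> n (x i) = sgn (a i)" if "i \<in> {1..N}" for i
      using face_n that by (simp add: \<eta> dual_face_def)
    have ext: "extended_support_grid \<phi> n y\<^sub>0 = {(t, v). t \<in> grid n \<and> v \<in> {-1, 1} \<and> \<eta> n t = v}"
      by (simp add: extended_support_grid_def \<eta>_def)
    have "\<exists>\<epsilon>. admissible n \<epsilon>"
    proof -
      obtain \<epsilon> :: "nat \<Rightarrow> real" where \<epsilon>: "\<And>i. i \<in> {1..N} \<Longrightarrow> \<epsilon> i \<in> {1, -1}"
        "\<And>t. t \<in> grid n \<Longrightarrow> \<bar>\<eta> n t\<bar> = 1 \<Longrightarrow> \<exists>i\<in>{1..N}. \<eta> n t = sgn (a i) \<and>
          (t = x i \<or> t = x i + torus_of (\<epsilon> i / 2 ^ n))"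
        using saturated_grid_points[OF Sn face_n spikes small] unfolding \<eta> by metis
      have "signed_support N a x \<subseteq> extended_support_grid \<phi> n y\<^sub>0"
        using Sn \<eta>_x a_nonzero unfolding ext signed_support_def
        by (auto simp: sgn_if image_subset_iff)
      moreover have "extended_support_grid \<phi> n y\<^sub>0 \<subseteq> signed_support N a x \<union>
          {(x i + torus_of (\<epsilon> i / 2 ^ n), \<eta> n (x i)) | i. i \<in> {1..N}}"
      proof (rule subrelI)
        fix t v
        assume "(t, v) \<in> extended_support_grid \<phi> n y\<^sub>0"
        then have tv: "t \<in> grid n" "\<bar>\<eta> n t\<bar> = 1" "\<eta> n t = v" unfolding ext by auto
        obtain i where i: "i \<in> {1..N}" "\<eta> n t = sgn (a i)"
          "t = x i \<or> t = x i + torus_of (\<epsilon> i / 2 ^ n)" using \<epsilon>(2)[OF tv(1,2)] by blast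
        then have "v = \<eta> n (x i)" "v = sgn (a i)" using tv(3) \<eta>_x by auto
        with i show "(t, v) \<in> signed_support N a x \<union>
            {(x i + torus_of (\<epsilon> i / 2 ^ n), \<eta> n (x i)) | i. i \<in> {1..N}}"
          unfolding signed_support_def by blast
      qed
      ultimately show ?thesis
        unfolding admissible_def using \<epsilon>(1) by blast
    qed
    moreover have "\<exists>\<alpha>>0. \<exists>lam\<^sub>0>0. \<forall>w\<in>L2. \<forall>lam. 0 < lam \<longrightarrow> lam < lam\<^sub>0 \<longrightarrow> L2_norm w / lam < \<alpha> \<longrightarrow>
        (\<forall>m. primal_solution_grid \<phi> n lam (\<lambda>t. y\<^sub>0 t + w t) m \<longrightarrow>
          measure_support m \<subseteq> x ` {1..N} \<union> {x i + torus_of (\<epsilon> i / 2 ^ n) | i. i \<in> {1..N}} \<and>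
          (\<forall>i\<in>{1..N}.
            (m {x i} \<noteq> 0 \<longrightarrow> sgn (m {x i}) = \<eta> n (x i)) \<and>
            (m {x i + torus_of (\<epsilon> i / 2 ^ n)} \<noteq> 0 \<longrightarrow>
              sgn (m {x i + torus_of (\<epsilon> i / 2 ^ n)}) = \<eta> n (x i))))"
      if adm: "admissible n \<epsilon>" for \<epsilon>
    proof -
      \<comment> \<open>These constants come from the certificate on the grid alone;
        \<open>\<epsilon>\<close> enters only afterwards, when the saturated points are
        located.\<close>
      obtain \<alpha> lam0 where \<alpha>: "\<alpha> > 0" "lam0 > 0" and sat:
        "\<And>w lam m. w \<in> L2 \<Longrightarrow> 0 < lam \<Longrightarrow> lam < lam0 \<Longrightarrow> L2_norm w / lam < \<alpha> \<Longrightarrow>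
          primal_solution_grid \<phi> n lam (\<lambda>t. y0 t + w t) m \<Longrightarrow>
          measure_support m \<subseteq> {t \<in> grid n. m {t} \<noteq> 0} \<and>
          (\<forall>t. m {t} \<noteq> 0 \<longrightarrow> t \<in> grid n \<and> inner (kernel_at \<phi> t) (P n) = sgn (m {t}))"
        using primal_solution_saturates[OF Sn face_n P(2)[OF n]] by blast
      have "measure_support m \<subseteq> x ` {1..N} \<union> {x i + torus_of (\<epsilon> i / 2 ^ n) | i. i \<in> {1..N}} \<and>
          (\<forall>i\<in>{1..N}.
            (m {x i} \<noteq> 0 \<longrightarrow> sgn (m {x i}) = \<eta> n (x i)) \<and>
            (m {x i + torus_of (\<epsilon> i / 2 ^ n)} \<noteq> 0 \<longrightarrow>
              sgn (m {x i + torus_of (\<epsilon> i / 2 ^ n)}) = \<eta> n (x i)))"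
        if prem: "w \<in> L2" "0 < lam" "lam < lam0" "L2_norm w / lam < \<alpha>"
          "primal_solution_grid \<phi> n lam (\<lambda>t. y\<^sub>0 t + w t) m" for w lam m
      proof (intro conjI ballI impI)
        have supp: "measure_support m \<subseteq> {t \<in> grid n. m {t} \<noteq> 0}"
          and sgn: "\<And>t. m {t} \<noteq> 0 \<Longrightarrow> t \<in> grid n \<and> \<eta> n t = sgn (m {t})"
          using sat[OF prem(1-4) prem(5)[unfolded y]] by (auto simp: \<eta>)
        show "measure_support m \<subseteq> x ` {1..N} \<union> {x i + torus_of (\<epsilon> i / 2 ^ n) | i. i \<in> {1..N}}"
        proof
          fix t assume "t \<in> measure_support m"
          then have t: "m {t} \<noteq> 0" using supp by auto
          then have "(t, sgn (m {t})) \<in> extended_support_grid \<phi> n y\<^sub>0"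
            using sgn[OF t] unfolding ext by (auto simp: sgn_if)
          then have "(t, sgn (m {t})) \<in> signed_support N a x \<union>
              {(x i + torus_of (\<epsilon> i / 2 ^ n), \<eta> n (x i)) | i. i \<in> {1..N}}"
            using adm unfolding admissible_def by blast
          then show "t \<in> x ` {1..N} \<union> {x i + torus_of (\<epsilon> i / 2 ^ n) | i. i \<in> {1..N}}"
            unfolding signed_support_def by blast
        qed
        fix i assume i: "i \<in> {1..N}"
        show "sgn (m {x i}) = \<eta> n (x i)" if "m {x i} \<noteq> 0"
          using sgn[OF that] by simp
        \<comment> \<open>The inclusion of the extended support does not say which spike accounts
          for this point. Its distance to \<open>x i\<close> is below \<open>r\<close>, and there
          the certificate times \<open>sgn (a i)\<close> exceeds 1/2, which fixes the sign.\<close>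
        let ?t = "x i + torus_of (\<epsilon> i / 2 ^ n)"
        assume t: "m {?t} \<noteq> 0"
        have "\<epsilon> i \<in> {1, -1}" using adm i unfolding admissible_def by blast
        then have "\<bar>\<epsilon> i\<bar> = 1" by auto
        then have "\<bar>\<epsilon> i / 2 ^ n\<bar> < r" using small by (simp add: abs_divide)
        then have "1/2 < sgn (a i) * \<eta> n ?t"
          using spikes i unfolding concave_spikes_def \<eta> by blast
        then show "sgn (m {?t}) = \<eta> n (x i)"
          using sgn[OF t] t \<eta>_x[OF i] by (auto simp: sgn_if split: if_splits)
      qed
      with \<alpha> show ?thesis by blast
    qed
    ultimately show "(\<exists>\<epsilon>. admissible n \<epsilon>) \<and>
      (\<forall>\<epsilon>. admissible n \<epsilon> \<longrightarrow>
        (\<exists>\<alpha>>0. \<exists>lam\<^sub>0>0. \<forall>w\<in>L2. \<forall>lam. 0 < lam \<longrightarrow> lam < lam\<^sub>0 \<longrightarrow> L2_norm w / lam < \<alpha> \<longrightarrow>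
          (\<forall>m. primal_solution_grid \<phi> n lam (\<lambda>t. y\<^sub>0 t + w t) m \<longrightarrow>
            measure_support m \<subseteq> x ` {1..N} \<union> {x i + torus_of (\<epsilon> i / 2 ^ n) | i. i \<in> {1..N}} \<and>
            (\<forall>i\<in>{1..N}.
              (m {x i} \<noteq> 0 \<longrightarrow> sgn (m {x i}) = \<eta> n (x i)) \<and>
              (m {x i + torus_of (\<epsilon> i / 2 ^ n)} \<noteq> 0 \<longrightarrow>
                sgn (m {x i + torus_of (\<epsilon> i / 2 ^ n)}) = \<eta> n (x i))))))"
      by blast
  qed
qed

end
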